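(* Let $G\subset O(d)$ be a finite group, let $\Omega\subset\mathbb{R}^d$ be invariant under $G$ (that is, $g\Omega=\Omega$ for all $g\in G$), and let $a:\Omega\to\mathbb{R}$ be invariant under $G$ (that is, $a(g\boldsymbol{x})=a(\boldsymbol{x})$ for all $g\in G$, $\boldsymbol{x}\in\Omega$). Suppose $\boldsymbol{q}:\Omega\to\mathbb{R}^m$ and $\mathbf{p}:\Omega\to\mathbb{R}^n$ are symmetry-adapted bases with respect to $G$, sufficiently regular that the entries of the two matrices below are well defined. Then the mass matrix $\langle \boldsymbol{q}, a\,\mathbf{p}^\top\rangle\in\mathbb{R}^{m\times n}$ and the stiffness matrix $\langle\nabla\boldsymbol{q},\nabla\mathbf{p}^\top\rangle\in\mathbb{R}^{m\times n}$ are block-diagonal after a permutation of rows and columns, where the number of blocks is at most the sum of the dimensions of all irreducible representations of $G$ (one from each isomorphism class).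
   Context: An orthogonal representation of a group $G$ is a homomorphism $\rho:G\to O(n)$, where $O(n)=\{Q\in\mathbb{R}^{n\times n}:Q^\top Q=I\}$ (with $O(1)=\{\pm1\}$); $n$ is its dimension. It is irreducible if the only subspaces $V\subset\mathbb{R}^n$ with $\rho(g)V\subset V$ for all $g\in G$ are the zero subspace and $\mathbb{R}^n$. Two irreducible representations $\rho,\tilde\rho:G\to O(n)$ are isomorphic if $\tilde\rho(g)=Q^\top\rho(g)Q$ for all $g\in G$ for some $Q\in O(n)$. A finite group $G$ has finitely many irreducible orthogonal representations up to isomorphism; fix one representative $\sigma_1,\ldots,\sigma_r$ of each isomorphism class and call these the canonical irreducible representations. A symmetry-respecting basis with respect to an orthogonal representation $\rho:G\to O(N)$ of $G\subset O(d)$ is a vector of functions $\mathbf{p}=(p_1,\ldots,p_N)^\top:\Omega\to\mathbb{R}^N$ satisfying $\mathbf{p}(g\boldsymbol{x})=\rho(g)\mathbf{p}(\boldsymbol{x})$ for all $g\in G$, $\boldsymbol{x}\in\Omega$. It is a symmetry-adapted basis if $\rho$ is block-diagonal with each block a canonical irreducible representation, i.e. $\rho(g)=\operatorname{diag}(\sigma_1(g)^{\oplus a_1},\ldots,\sigma_r(g)^{\oplus a_r})$ for some integers $a_1,\ldots,a_r\ge 0$, where $A^{\oplus k}=\operatorname{diag}(A,\ldots,A)$ ($k$ times). The inner product is $\langle f,g\rangle=\int_\Omega f(\boldsymbol{x})g(\boldsymbol{x})\,d\boldsymbol{x}$ for scalar functions, and $\langle\nabla f,\nabla g\rangle=\int_\Omega\nabla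 f(\boldsymbol{x})\cdot\nabla g(\boldsymbol{x})\,d\boldsymbol{x}$. For vectors of functions the inner products act entrywise: $\langle\boldsymbol{q},a\,\mathbf{p}^\top\rangle$ is the matrix with $(i,j)$ entry $\langle q_i,a\,p_j\rangle$, and $\langle\nabla\boldsymbol{q},\nabla\mathbf{p}^\top\rangle$ is the matrix with $(i,j)$ entry $\langle\nabla q_i,\nabla p_j\rangle$. The blocks in a block-diagonal matrix are allowed to be rectangular. *)

theory Defs
  imports
    "HOL-Analysis.Analysis"
    "HOL-Algebra.Group"
    "HOL-Combinatorics.Permutations"
    "Jordan_Normal_Form.VS_Connect"
begin

section \<open>Orthogonal groups and representations\<close>

text \<open>
  The group acts on a Euclidean space of fixed dimension, so its elements have type
  \<open>real ^ 'd ^ 'd\<close>.  Representations of all dimensions have to be compared with each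
  other, so they take values in matrices whose dimension is a natural number.
\<close>

definition ambient_orthogonal_group :: "(real ^ 'd ^ 'd) monoid" where
  "ambient_orthogonal_group =
     \<lparr>carrier = {Q. orthogonal_matrix Q}, mult = (**), one = Finite_Cartesian_Product.mat 1\<rparr>"

definition orthogonal_group :: "nat \<Rightarrow> real mat monoid" where
  "orthogonal_group n =
     \<lparr>carrier = {Q \<in> carrier_mat n n. transpose_mat Q * Q = 1\<^sub>m n}, mult = (*), one = 1\<^sub>m n\<rparr>"

definition orthogonal_rep ::
    "(real ^ 'd ^ 'd) set \<Rightarrow> nat \<Rightarrow> (real ^ 'd ^ 'd \<Rightarrow> real mat) \<Rightarrow> bool" where
  "orthogonal_rep G n \<rho> \<longleftrightarrow>
     \<rho> \<in> hom (ambient_orthogonal_group\<lparr>carrier := G\<rparr>) (orthogonal_group n)"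

text \<open>As usual, a representation of dimension \<open>0\<close> does not count as irreducible.\<close>

definition irreducible_rep ::
    "(real ^ 'd ^ 'd) set \<Rightarrow> nat \<Rightarrow> (real ^ 'd ^ 'd \<Rightarrow> real mat) \<Rightarrow> bool" where
  "irreducible_rep G n \<rho> \<longleftrightarrow>
     orthogonal_rep G n \<rho> \<and> n > 0 \<and>
     (\<forall>V. VectorSpace.subspace class_ring V (module_vec TYPE(real) n) \<and>
          (\<forall>g\<in>G. (\<lambda>v. \<rho> g *\<^sub>v v) ` V \<subseteq> V)
        \<longrightarrow> V = {0\<^sub>v n} \<or> V = carrier_vec n)"

definition isomorphic_reps ::
    "(real ^ 'd ^ 'd) set \<Rightarrow> nat \<Rightarrow> (real ^ 'd ^ 'd \<Rightarrow> real mat) \<Rightarrow>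
       nat \<Rightarrow> (real ^ 'd ^ 'd \<Rightarrow> real mat) \<Rightarrow> bool" where
  "isomorphic_reps G n \<rho> n' \<rho>' \<longleftrightarrow>
     n = n' \<and> (\<exists>Q \<in> carrier (orthogonal_group n). \<forall>g\<in>G. \<rho>' g = transpose_mat Q * \<rho> g * Q)"

text \<open>
  \<open>\<sigma> 0, \<dots>, \<sigma> (r - 1)\<close>, of dimensions \<open>dims 0, \<dots>, dims (r - 1)\<close>, contain exactly one
  representative of each isomorphism class of irreducible representations.
\<close>

definition canonical_irreps ::
    "(real ^ 'd ^ 'd) set \<Rightarrow> nat \<Rightarrow> (nat \<Rightarrow> nat) \<Rightarrow> (nat \<Rightarrow> real ^ 'd ^ 'd \<Rightarrow> real mat) \<Rightarrow> bool"
  where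
  "canonical_irreps G r dims \<sigma> \<longleftrightarrow>
     (\<forall>i<r. irreducible_rep G (dims i) (\<sigma> i)) \<and>
     (\<forall>i<r. \<forall>j<r. i \<noteq> j \<longrightarrow> \<not> isomorphic_reps G (dims i) (\<sigma> i) (dims j) (\<sigma> j)) \<and>
     (\<forall>n \<rho>. irreducible_rep G n \<rho> \<longrightarrow> (\<exists>i<r. isomorphic_reps G n \<rho> (dims i) (\<sigma> i)))"

section \<open>Symmetry-adapted bases\<close>

definition symmetry_respecting_basis ::
    "(real ^ 'd ^ 'd) set \<Rightarrow> (real ^ 'd) set \<Rightarrow> nat \<Rightarrow> (real ^ 'd ^ 'd \<Rightarrow> real mat) \<Rightarrow>
       (real ^ 'd \<Rightarrow> real vec) \<Rightarrow> bool" where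
  "symmetry_respecting_basis G \<Omega> N \<rho> p \<longleftrightarrow>
     orthogonal_rep G N \<rho> \<and>
     (\<forall>x\<in>\<Omega>. p x \<in> carrier_vec N) \<and>
     (\<forall>g\<in>G. \<forall>x\<in>\<Omega>. p (g *v x) = \<rho> g *\<^sub>v p x)"

definition adapted_rep ::
    "nat \<Rightarrow> (nat \<Rightarrow> real ^ 'd ^ 'd \<Rightarrow> real mat) \<Rightarrow> (nat \<Rightarrow> nat) \<Rightarrow> real ^ 'd ^ 'd \<Rightarrow> real mat" where
  "adapted_rep r \<sigma> a g = diag_block_mat (concat (map (\<lambda>i. replicate (a i) (\<sigma> i g)) [0..<r]))"

definition symmetry_adapted_basis ::
    "(real ^ 'd ^ 'd) set \<Rightarrow> (real ^ 'd) set \<Rightarrow> nat \<Rightarrow> (nat \<Rightarrow> real ^ 'd ^ 'd \<Rightarrow> real mat) \<Rightarrow>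
       (nat \<Rightarrow> nat) \<Rightarrow> nat \<Rightarrow> (real ^ 'd \<Rightarrow> real vec) \<Rightarrow> bool" where
  "symmetry_adapted_basis G \<Omega> r \<sigma> a N p \<longleftrightarrow>
     symmetry_respecting_basis G \<Omega> N (adapted_rep r \<sigma> a) p"

section \<open>Gradients, mass matrix and stiffness matrix\<close>

text \<open>
  The set \<open>\<Omega>\<close> need not be open, and only the values on \<open>\<Omega>\<close> matter, so derivatives are taken
  within \<open>\<Omega>\<close>; such a derivative may fail to be unique where \<open>\<Omega>\<close> is thin.  The gradient is
  well defined at \<open>x\<close> if it exists and is unique; at interior points this just means
  differentiability.
\<close>

definition has_gradient_within ::
    "(real ^ 'd) set \<Rightarrow> (real ^ 'd \<Rightarrow> real) \<Rightarrow> real ^ 'd \<Rightarrow> real ^ 'd \<Rightarrow> bool" where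
  "has_gradient_within \<Omega> f x v \<longleftrightarrow> (f has_derivative (\<lambda>h. h \<bullet> v)) (at x within \<Omega>)"

definition gradient_within ::
    "(real ^ 'd) set \<Rightarrow> (real ^ 'd \<Rightarrow> real) \<Rightarrow> real ^ 'd \<Rightarrow> real ^ 'd" where
  "gradient_within \<Omega> f x = (THE v. has_gradient_within \<Omega> f x v)"

definition gradient_well_defined :: "(real ^ 'd) set \<Rightarrow> (real ^ 'd \<Rightarrow> real) \<Rightarrow> bool" where
  "gradient_well_defined \<Omega> f \<longleftrightarrow> (AE x in lebesgue. x \<in> \<Omega> \<longrightarrow> (\<exists>!v. has_gradient_within \<Omega> f x v))"

definition mass_matrix ::
    "(real ^ 'd) set \<Rightarrow> (real ^ 'd \<Rightarrow> real) \<Rightarrow> nat \<Rightarrow> nat \<Rightarrow>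
       (real ^ 'd \<Rightarrow> real vec) \<Rightarrow> (real ^ 'd \<Rightarrow> real vec) \<Rightarrow> real mat" where
  "mass_matrix \<Omega> a m n q p =
     Matrix.mat m n (\<lambda>(i, j). LINT x:\<Omega>|lebesgue. q x $ i * (a x * p x $ j))"

definition stiffness_matrix ::
    "(real ^ 'd) set \<Rightarrow> nat \<Rightarrow> nat \<Rightarrow>
       (real ^ 'd \<Rightarrow> real vec) \<Rightarrow> (real ^ 'd \<Rightarrow> real vec) \<Rightarrow> real mat" where
  "stiffness_matrix \<Omega> m n q p =
     Matrix.mat m n (\<lambda>(i, j). LINT x:\<Omega>|lebesgue.
       gradient_within \<Omega> (\<lambda>y. q y $ i) x \<bullet> gradient_within \<Omega> (\<lambda>y. p y $ j) x)"

definition mass_entries_well_defined ::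
    "(real ^ 'd) set \<Rightarrow> (real ^ 'd \<Rightarrow> real) \<Rightarrow> nat \<Rightarrow> nat \<Rightarrow>
       (real ^ 'd \<Rightarrow> real vec) \<Rightarrow> (real ^ 'd \<Rightarrow> real vec) \<Rightarrow> bool" where
  "mass_entries_well_defined \<Omega> a m n q p \<longleftrightarrow>
     (\<forall>i<m. \<forall>j<n. set_integrable lebesgue \<Omega> (\<lambda>x. q x $ i * (a x * p x $ j)))"

definition stiffness_entries_well_defined ::
    "(real ^ 'd) set \<Rightarrow> nat \<Rightarrow> nat \<Rightarrow>
       (real ^ 'd \<Rightarrow> real vec) \<Rightarrow> (real ^ 'd \<Rightarrow> real vec) \<Rightarrow> bool" where
  "stiffness_entries_well_defined \<Omega> m n q p \<longleftrightarrow>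
     (\<forall>i<m. gradient_well_defined \<Omega> (\<lambda>y. q y $ i)) \<and>
     (\<forall>j<n. gradient_well_defined \<Omega> (\<lambda>y. p y $ j)) \<and>
     (\<forall>i<m. \<forall>j<n. set_integrable lebesgue \<Omega>
       (\<lambda>x. gradient_within \<Omega> (\<lambda>y. q y $ i) x \<bullet> gradient_within \<Omega> (\<lambda>y. p y $ j) x))"

section \<open>Block structure\<close>

definition permute_mat :: "(nat \<Rightarrow> nat) \<Rightarrow> (nat \<Rightarrow> nat) \<Rightarrow> 'a mat \<Rightarrow> 'a mat" where
  "permute_mat \<pi> \<tau> A = Matrix.mat (dim_row A) (dim_col A) (\<lambda>(i, j). A $$ (\<pi> i, \<tau> j))"

text \<open>
  The \<open>b\<close>-th diagonal block has size \<open>rs ! b \<times> cs ! b\<close>; blocks may be rectangular.  A block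
  may have no rows or no columns: it then accounts for zero columns or rows of the matrix,
  as when an irreducible representation occurs in only one of the two bases.
\<close>

definition block_diagonal :: "nat list \<Rightarrow> nat list \<Rightarrow> real mat \<Rightarrow> bool" where
  "block_diagonal rs cs A \<longleftrightarrow>
     (\<exists>Bs. A = diag_block_mat Bs \<and> map dim_row Bs = rs \<and> map dim_col Bs = cs)"

text \<open>The block containing position \<open>s\<close> when consecutive blocks have sizes \<open>ns\<close>.\<close>

definition block_of :: "nat list \<Rightarrow> nat \<Rightarrow> nat" where
  "block_of ns s = (LEAST b. s < sum_list (take (Suc b) ns))"

text \<open>
  Entry \<open>s\<close> of this list is \<open>(i, k)\<close> if the \<open>s\<close>-th function of a symmetry-adapted basis with
  multiplicities \<open>a\<close> is the \<open>k\<close>-th component of a copy of \<open>\<sigma> i\<close>.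
\<close>

definition symmetry_types :: "nat \<Rightarrow> (nat \<Rightarrow> nat) \<Rightarrow> (nat \<Rightarrow> nat) \<Rightarrow> (nat \<times> nat) list" where
  "symmetry_types r dims a =
     concat (map (\<lambda>i. concat (replicate (a i) (map (Pair i) [0..<dims i]))) [0..<r])"

definition scalar_commutant ::
    "(real ^ 'd ^ 'd) set \<Rightarrow> nat \<Rightarrow> (real ^ 'd ^ 'd \<Rightarrow> real mat) \<Rightarrow> bool" where
  "scalar_commutant G n \<rho> \<longleftrightarrow>
     (\<forall>A \<in> carrier_mat n n. (\<forall>g\<in>G. A * \<rho> g = \<rho> g * A) \<longrightarrow> (\<exists>c. A = c \<cdot>\<^sub>m 1\<^sub>m n))"

text \<open>
  A matrix is block-diagonal with a single block for trivial reasons, so an upper bound on the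
  number of blocks alone says little.  The following predicate says that the blocks are those
  coming from the symmetry: a block involves one irreducible representation only, and only one
  of its components if the representation has scalar commutant.  Over the reals the last
  proviso is necessary: for the planar rotations by multiples of \<open>2\<pi>/3\<close>, the mass matrix of
  \<open>(x, y)\<close> and a rotated copy of \<open>(x, y)\<close> on the unit disk can have four nonzero entries.
\<close>

definition blocks_separate_symmetry_types ::
    "(real ^ 'd ^ 'd) set \<Rightarrow> (nat \<Rightarrow> nat) \<Rightarrow> (nat \<Rightarrow> real ^ 'd ^ 'd \<Rightarrow> real mat) \<Rightarrow>
       (nat \<times> (nat \<times> nat)) set \<Rightarrow> bool" where
  "blocks_separate_symmetry_types G dims \<sigma> S \<longleftrightarrow>
     (\<forall>b i k i' k'. (b, (i, k)) \<in> S \<and> (b, (i', k')) \<in> S \<longrightarrow>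
        i = i' \<and> (scalar_commutant G (dims i) (\<sigma> i) \<longrightarrow> k = k'))"

end

theory Submission
  imports Defs "Jordan_Normal_Form.Spectral_Radius" "Jordan_Normal_Form.Matrix_Kernel"
begin

text \<open>
  Orthogonal maps preserve Lebesgue measure.  Substituting \<open>x \<mapsto> g x\<close> in the integrals that define the
  entries therefore shows that the mass matrix \<open>M\<close> satisfies \<open>\<rho>(g) M = M \<rho>'(g)\<close> for all \<open>g \<in> G\<close>,
  where \<open>\<rho>\<close> and \<open>\<rho>'\<close> are the block-diagonal representations of the two bases.  The same holds for the
  stiffness matrix: by the chain rule, gradients transform like the functions, up to an
  application of \<open>g\<close> that the inner product does not see.  This is the content of
  \<open>mass_matrix_intertwiner\<close> and \<open>stiffness_matrix_intertwiner\<close>.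

  An intertwiner of two direct sums consists of intertwiners between the summands.  By Schur's lemma
  those between different canonical representations vanish, and if a representation has scalar
  commutant, those between two copies of it are multiples of the identity
  (\<open>intertwiner_nonzero_entry\<close>).  So an entry of \<open>M\<close> can be nonzero only if its row and its column belong
  to the same representation \<open>\<sigma> i\<close> and, in the case of a scalar commutant, to the same
  component \<open>k\<close> of it.

  Rows and columns are therefore labelled by the pair \<open>(i, k)\<close>, or by \<open>i\<close> alone when the commutant of
  \<open>\<sigma> i\<close> is larger than the scalars.  A representation of dimension \<open>d\<close> contributes at most \<open>d\<close>
  labels.  Sorting rows and columns by label (\<open>sort_by_key\<close>) makes \<open>M\<close> block-diagonal with
  one block for each label, padded by empty blocks up to the sum of all dimensions.  The permutations and the block sizes depend on the labels only, so they serve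
  both matrices at once.
\<close>

section \<open>Orthogonal invariance of Lebesgue measure\<close>

lemma nn_integral_lborel_shift:
  fixes f :: "'a::euclidean_space \<Rightarrow> ennreal"
  assumes "f \<in> borel_measurable borel"
  shows "(\<integral>\<^sup>+y. f (y + c) \<partial>lborel) = (\<integral>\<^sup>+y. f y \<partial>lborel)"
  using nn_integral_distr[of "(+) c" lborel borel f] lborel_distr_plus[of c] assms
  by (simp add: add.commute[of c])

text \<open>
  Uniqueness of Haar measure, in the case at hand.  The transported measure is again translation
  invariant, so by Fubini it is proportional to Lebesgue measure: for a test set \<open>B\<close>, the product
  of \<open>vol B\<close> and the transported measure of \<open>A\<close> is turned into \<open>vol B * vol A\<close> by shifting one
  variable at a time.  The orthogonal map leaves the unit ball unchanged, so taking that ball for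
  \<open>B\<close> gives the proportionality constant \<open>1\<close>.
\<close>

lemma distr_lborel_orthogonal:
  fixes g :: "'a::euclidean_space \<Rightarrow> 'a"
  assumes g: "orthogonal_transformation g"
  shows "distr lborel borel g = lborel"
proof (rule measure_eqI)
  obtain h where h: "orthogonal_transformation h" and gh: "\<And>x. g (h x) = x"
    using orthogonal_transformation_inv[OF g] orthogonal_transformation_surj[OF g]
    by (metis surj_f_inv_f)
  have lin: "linear g" using g by (rule orthogonal_transformation_linear)
  \<comment> \<open>Shifting the argument by \<open>h x\<close> shifts the value by \<open>x\<close>: this is the translation invariance of
    the transported measure.\<close>
  have add: "g (y + h x) = g y + x" for x y
    using lin gh by (simp add: linear_add)
  have [measurable]: "g \<in> borel_measurable borel" "h \<in> borel_measurable borel"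
    using g h by (auto intro!: borel_measurable_continuous_onI linear_continuous_on
        simp: orthogonal_transformation_linear linear_conv_bounded_linear[symmetric])
  define B where "B = ball (0::'a) 1"
  have [measurable]: "B \<in> sets borel" by (simp add: B_def)
  have B: "emeasure lborel B \<noteq> 0" "emeasure lborel B \<noteq> \<infinity>"
    using emeasure_lborel_ball_finite[of "0::'a" 1] content_ball_pos[of 1 "0::'a"]
    by (auto simp: measure_def B_def)
  fix A :: "'a set" assume "A \<in> sets (distr lborel borel g)"
  then have [measurable]: "A \<in> sets borel" by simp
  have "emeasure lborel B * emeasure (distr lborel borel g) A =
    (\<integral>\<^sup>+x. (\<integral>\<^sup>+y. indicator B x * indicator A (g y) \<partial>lborel) \<partial>lborel)"
  proof -
    have "emeasure (distr lborel borel g) A = (\<integral>\<^sup>+y. indicator A (g y) \<partial>lborel)"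
      by (subst nn_integral_indicator[symmetric], simp, subst nn_integral_distr) simp_all
    moreover have "(\<integral>\<^sup>+x. indicator B x * c \<partial>lborel) = emeasure lborel B * c" for c :: ennreal
      by (simp add: nn_integral_multc borel_measurable_indicator)
    ultimately show ?thesis
      by (simp add: nn_integral_cmult)
  qed
  also have "\<dots> = (\<integral>\<^sup>+x. (\<integral>\<^sup>+y. indicator B x * indicator A (g (y + h x)) \<partial>lborel) \<partial>lborel)"
    by (intro nn_integral_cong nn_integral_lborel_shift[symmetric]) measurable
  also have "\<dots> = (\<integral>\<^sup>+x. (\<integral>\<^sup>+y. indicator B x * indicator A (x + g y) \<partial>lborel) \<partial>lborel)"
    by (simp add: add add.commute)
  also have "\<dots> = (\<integral>\<^sup>+y. (\<integral>\<^sup>+x. indicator B x * indicator A (x + g y) \<partial>lborel) \<partial>lborel)"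
    by (rule lborel_pair.Fubini') measurable
  also have "\<dots> = (\<integral>\<^sup>+y. (\<integral>\<^sup>+x. indicator B (x - g y) * indicator A x \<partial>lborel) \<partial>lborel)"
  proof (rule nn_integral_cong)
    fix y
    show "(\<integral>\<^sup>+x. indicator B x * indicator A (x + g y) \<partial>lborel) =
        (\<integral>\<^sup>+x. indicator B (x - g y) * indicator A x \<partial>lborel)"
      using nn_integral_lborel_shift[of "\<lambda>x. indicator B (x - g y) * indicator A x" "g y"]
      by simp
  qed
  also have "\<dots> = (\<integral>\<^sup>+x. (\<integral>\<^sup>+y. indicator B (x - g y) * indicator A x \<partial>lborel) \<partial>lborel)"
    by (rule lborel_pair.Fubini') measurable
  also have "\<dots> = (\<integral>\<^sup>+x. (\<integral>\<^sup>+y. indicator B (x - g (y + h x)) * indicator A x \<partial>lborel) \<partial>lborel)"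
    by (intro nn_integral_cong nn_integral_lborel_shift[symmetric,
          where f = "\<lambda>y. indicator B (x - g y) * indicator A x" for x]) measurable
  also have "\<dots> = (\<integral>\<^sup>+x. (\<integral>\<^sup>+y. indicator B y * indicator A x \<partial>lborel) \<partial>lborel)"
    by (simp add: add B_def diff_add_eq_diff_diff_swap orthogonal_transformation_norm[OF g] indicator_def)
  also have "\<dots> = emeasure lborel B * emeasure lborel A"
    by (simp add: nn_integral_cmult nn_integral_multc borel_measurable_indicator)
  finally show "emeasure (distr lborel borel g) A = emeasure lborel A"
    using B by (simp add: ennreal_mult_cancel_left)
qed simp

text \<open>
  The matrix entries are integrals with respect to the completed measure, so invariance has to be
  carried over to it.  Null sets are what has to be checked.
\<close>

lemma distr_lebesgue_orthogonal:
  fixes g :: "'a::euclidean_space \<Rightarrow> 'a"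
  assumes g: "orthogonal_transformation g"
  shows "g \<in> lebesgue \<rightarrow>\<^sub>M lebesgue" "distr lebesgue lebesgue g = lebesgue"
proof -
  have [measurable]: "g \<in> borel_measurable borel"
    using g by (auto intro!: borel_measurable_continuous_onI linear_continuous_on
        simp: orthogonal_transformation_linear linear_conv_bounded_linear[symmetric])
  have d: "distr lborel lborel g = lborel"
    using distr_lborel_orthogonal[OF g] by (simp cong: distr_cong)
  have null: "null_sets (distr lebesgue lborel g) = null_sets lborel"
    using d by (simp add: distr_completion)
  have m': "g \<in> lebesgue \<rightarrow>\<^sub>M lborel"
    by (simp add: measurable_completion)
  show "g \<in> lebesgue \<rightarrow>\<^sub>M lebesgue"
    by (rule completion.measurable_completion2[OF m']) (simp add: null)
  show "distr lebesgue lebesgue g = lebesgue"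
    using completion.completion_distr_eq[OF m' null] d by (simp add: distr_completion)
qed

lemma lebesgue_integral_orthogonal:
  fixes g :: "'a::euclidean_space \<Rightarrow> 'a" and f :: "'a \<Rightarrow> real"
  assumes g: "orthogonal_transformation g" and f: "integrable lebesgue f"
  shows "integrable lebesgue (\<lambda>x. f (g x))" "(LINT x|lebesgue. f (g x)) = (LINT x|lebesgue. f x)"
  using distr_lebesgue_orthogonal[OF g] f
    integrable_distr_eq[of g lebesgue lebesgue f] integral_distr[of g lebesgue lebesgue f]
  by (auto simp: borel_measurable_integrable)

section \<open>Gradients under orthogonal symmetries\<close>

lemma orthogonal_transformation_matrix_vector:
  fixes g :: "real ^ 'd ^ 'd"
  assumes "orthogonal_matrix g"
  shows "orthogonal_transformation ((*v) g)"
  using assms by (simp add: orthogonal_transformation_matrix)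

lemma invariant_set_iff:
  fixes g :: "real ^ 'd ^ 'd"
  assumes "orthogonal_matrix g" "(\<lambda>x. g *v x) ` \<Omega> = \<Omega>"
  shows "g *v x \<in> \<Omega> \<longleftrightarrow> x \<in> \<Omega>"
proof -
  have "inj ((*v) g)"
    using assms(1) orthogonal_transformation_inj orthogonal_transformation_matrix_vector by blast
  from inj_image_mem_iff[OF this, of x \<Omega>] show ?thesis by (simp add: assms(2))
qed

text \<open>
  Chain rule: the derivative of \<open>f\<close> is only taken within \<open>\<Omega>\<close>, which suffices because the matrix maps
  \<open>\<Omega>\<close> onto itself.
\<close>

lemma has_gradient_within_compose:
  fixes g :: "real ^ 'd ^ 'd"
  assumes f: "has_gradient_within \<Omega> f (g *v x) w" and g: "(\<lambda>x. g *v x) ` \<Omega> = \<Omega>"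
  shows "has_gradient_within \<Omega> (\<lambda>y. f (g *v y)) x (transpose g *v w)"
proof -
  have "((\<lambda>y. f (g *v y)) has_derivative (\<lambda>h. (g *v h) \<bullet> w)) (at x within \<Omega>)"
    using f g unfolding has_gradient_within_def
    by (intro has_derivative_in_compose[of "\<lambda>y. g *v y" "\<lambda>y. g *v y" x \<Omega> f "\<lambda>h. h \<bullet> w"])
       (auto intro!: bounded_linear_imp_has_derivative)
  moreover have "(g *v h) \<bullet> w = h \<bullet> (transpose g *v w)" for h
    by (metis dot_lmul_matrix inner_commute transpose_matrix_vector)
  ultimately show ?thesis by (simp add: has_gradient_within_def)
qed

text \<open>
  Gradients of the basis functions transform like the functions themselves, up to the action
  of \<open>g\<close> on the ambient space.  Whether an existing gradient is unique depends only on \<open>\<Omega>\<close> near the point,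
  and \<open>g\<close> carries a neighbourhood of \<open>x\<close> in \<open>\<Omega>\<close> to one of \<open>g x\<close>; hence unique gradients at \<open>x\<close>
  give unique gradients at \<open>g x\<close>.
\<close>

lemma gradient_within_equivariant:
  fixes f :: "nat \<Rightarrow> real ^ 'd \<Rightarrow> real" and g :: "real ^ 'd ^ 'd"
  assumes g: "orthogonal_matrix g" "(\<lambda>x. g *v x) ` \<Omega> = \<Omega>"
    and equi: "\<And>i y. i < m \<Longrightarrow> y \<in> \<Omega> \<Longrightarrow> f i (g *v y) = (\<Sum>k<m. R $$ (i, k) * f k y)"
    and x: "x \<in> \<Omega>" and ex1: "\<And>k. k < m \<Longrightarrow> \<exists>!v. has_gradient_within \<Omega> (f k) x v" and i: "i < m"
  shows "gradient_within \<Omega> (f i) (g *v x) = g *v (\<Sum>k<m. R $$ (i, k) *\<^sub>R gradient_within \<Omega> (f k) x)"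
proof -
  define v where "v = (\<Sum>k<m. R $$ (i, k) *\<^sub>R gradient_within \<Omega> (f k) x)"
  have inv: "g *v (transpose g *v y) = y" "transpose g *v (g *v y) = y" for y
    using g(1) by (simp_all add: orthogonal_matrix_def matrix_vector_mul_assoc del: transpose_matrix_vector)
  have gt: "(\<lambda>x. transpose g *v x) ` \<Omega> = \<Omega>"
    by (subst g(2)[symmetric]) (simp add: image_image inv del: transpose_matrix_vector)
  have grad: "has_gradient_within \<Omega> (f k) x (gradient_within \<Omega> (f k) x)" if "k < m" for k
    unfolding gradient_within_def by (rule theI') (rule ex1[OF that])
  have "has_gradient_within \<Omega> (\<lambda>y. \<Sum>k<m. R $$ (i, k) * f k y) x v"
    using grad unfolding has_gradient_within_def v_def
    by (auto simp: inner_sum_right intro!: has_derivative_sum has_derivative_mult_right)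
  then have comp: "has_gradient_within \<Omega> (\<lambda>y. f i (g *v y)) x v"
    unfolding has_gradient_within_def
    by (rule has_derivative_transform[OF x, rotated]) (simp add: equi[OF i])
  have "has_gradient_within \<Omega> (f i) (g *v x) (g *v v)"
    using has_gradient_within_compose[OF _ gt, of "\<lambda>y. f i (g *v y)" "g *v x" v] comp
    by (simp add: inv transpose_transpose del: transpose_matrix_vector)
  moreover have "w = g *v v" if w: "has_gradient_within \<Omega> (f i) (g *v x) w" for w
  proof -
    \<comment> \<open>Two gradients of \<open>f i \<circ> g\<close> at \<open>x\<close> differ by a gradient of the zero function there, which can be
      added to that of \<open>f i\<close>, whose gradient at \<open>x\<close> is unique.\<close>
    have "has_gradient_within \<Omega> (\<lambda>y. f i (g *v y)) x (transpose g *v w)"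
      by (rule has_gradient_within_compose[OF w g(2)])
    with comp grad[OF i]
    have "has_gradient_within \<Omega> (\<lambda>y. f i y + (f i (g *v y) - f i (g *v y))) x
        (gradient_within \<Omega> (f i) x + (transpose g *v w - v))"
      unfolding has_gradient_within_def inner_add_right inner_diff_right
      by (intro has_derivative_add has_derivative_diff)
    then have "has_gradient_within \<Omega> (f i) x (gradient_within \<Omega> (f i) x + (transpose g *v w - v))"
      by simp
    then have "gradient_within \<Omega> (f i) x + (transpose g *v w - v) = gradient_within \<Omega> (f i) x"
      using ex1[OF i] grad[OF i] by blast
    then have "transpose g *v w = v" by simp
    then show ?thesis using inv(1)[of w] by simp
  qed
  ultimately show ?thesis
    unfolding gradient_within_def[of \<Omega> "f i" "g *v x"] v_def by (rule the_equality)
qed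

section \<open>Mass and stiffness matrices as intertwiners\<close>

text \<open>
  The change of variables \<open>x \<mapsto> g x\<close> leaves the integrals unchanged and expands the integrand, so
  \<open>M = R M P\<^sup>T\<close>; multiplying by \<open>P\<close> on the right gives the intertwining relation.  Both the mass
  and the stiffness matrix are instances.
\<close>

lemma equivariant_integrals_intertwine:
  fixes g :: "'a::euclidean_space \<Rightarrow> 'a" and F :: "nat \<Rightarrow> nat \<Rightarrow> 'a \<Rightarrow> real"
  assumes g: "orthogonal_transformation g"
    and int: "\<And>i j. i < m \<Longrightarrow> j < n \<Longrightarrow> integrable lebesgue (F i j)"
    and equi: "\<And>i j. i < m \<Longrightarrow> j < n \<Longrightarrow>
      AE x in lebesgue. F i j (g x) = (\<Sum>k<m. \<Sum>l<n. R $$ (i, k) * P $$ (j, l) * F k l x)"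
    and R: "R \<in> carrier_mat m m" and P: "P \<in> carrier_mat n n" "transpose_mat P * P = 1\<^sub>m n"
  defines "M \<equiv> Matrix.mat m n (\<lambda>(i, j). LINT x|lebesgue. F i j x)"
  shows "R * M = M * P"
proof -
  have M: "M \<in> carrier_mat m n" by (simp add: M_def)
  have RM: "R * M \<in> carrier_mat m n" using R M by simp
  have Pt: "transpose_mat P \<in> carrier_mat n n" using P by simp
  have "M = R * M * transpose_mat P"
  proof (rule eq_matI)
    fix i j assume "i < dim_row (R * M * transpose_mat P)" "j < dim_col (R * M * transpose_mat P)"
    then have ij: "i < m" "j < n" using R P by simp_all
    have "M $$ (i, j) = (LINT x|lebesgue. F i j (g x))"
      using ij lebesgue_integral_orthogonal(2)[OF g int] by (simp add: M_def)
    also have "\<dots> = (LINT x|lebesgue. (\<Sum>k<m. \<Sum>l<n. R $$ (i, k) * P $$ (j, l) * F k l x))"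
      using int equi[OF ij] lebesgue_integral_orthogonal(1)[OF g int[OF ij]]
      by (intro integral_cong_AE) (auto intro!: borel_measurable_sum borel_measurable_times
          simp: borel_measurable_integrable)
    also have "\<dots> = (\<Sum>k<m. \<Sum>l<n. R $$ (i, k) * P $$ (j, l) * M $$ (k, l))"
    proof -
      have int': "integrable lebesgue (\<lambda>x. R $$ (i, k) * P $$ (j, l) * F k l x)" if "k < m" "l < n" for k l
        using int[OF that] by simp
      then have "(LINT x|lebesgue. (\<Sum>k<m. \<Sum>l<n. R $$ (i, k) * P $$ (j, l) * F k l x)) =
          (\<Sum>k<m. LINT x|lebesgue. (\<Sum>l<n. R $$ (i, k) * P $$ (j, l) * F k l x))"
        by (intro Bochner_Integration.integral_sum Bochner_Integration.integrable_sum) simp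
      also have "\<dots> = (\<Sum>k<m. \<Sum>l<n. LINT x|lebesgue. R $$ (i, k) * P $$ (j, l) * F k l x)"
        using int' by (intro sum.cong refl Bochner_Integration.integral_sum) simp
      finally show ?thesis by (simp add: M_def)
    qed
    also have "\<dots> = (R * M * transpose_mat P) $$ (i, j)"
      using ij R M P by (simp add: scalar_prod_def sum_distrib_left atLeast0LessThan mult_ac)
    finally show "M $$ (i, j) = (R * M * transpose_mat P) $$ (i, j)" .
  qed (use R M P in auto)
  then have "M * P = R * M * transpose_mat P * P" by simp
  also have "\<dots> = R * M * (transpose_mat P * P)" by (rule assoc_mult_mat[OF RM Pt P(1)])
  also have "\<dots> = R * M" by (simp only: P(2) right_mult_one_mat[OF RM])
  finally show ?thesis ..
qed

lemma index_mult_mat_vec_sum: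
  assumes "R \<in> carrier_mat m n" "v \<in> carrier_vec n" "i < m"
  shows "(R *\<^sub>v v) $ i = (\<Sum>k<n. R $$ (i, k) * (v $ k :: real))"
  using assms by (simp add: scalar_prod_def atLeast0LessThan)

lemma mass_matrix_intertwiner:
  fixes g :: "real ^ 'd ^ 'd"
  assumes g: "orthogonal_matrix g" "(\<lambda>x. g *v x) ` \<Omega> = \<Omega>" and a: "\<And>x. x \<in> \<Omega> \<Longrightarrow> a (g *v x) = a x"
    and q: "\<And>x. x \<in> \<Omega> \<Longrightarrow> q x \<in> carrier_vec m" "\<And>x. x \<in> \<Omega> \<Longrightarrow> q (g *v x) = R *\<^sub>v q x"
    and p: "\<And>x. x \<in> \<Omega> \<Longrightarrow> p x \<in> carrier_vec n" "\<And>x. x \<in> \<Omega> \<Longrightarrow> p (g *v x) = P *\<^sub>v p x"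
    and R: "R \<in> carrier_mat m m" and P: "P \<in> carrier_mat n n" "transpose_mat P * P = 1\<^sub>m n"
    and wd: "mass_entries_well_defined \<Omega> a m n q p"
  shows "R * mass_matrix \<Omega> a m n q p = mass_matrix \<Omega> a m n q p * P"
  unfolding mass_matrix_def set_lebesgue_integral_def
proof (rule equivariant_integrals_intertwine[OF orthogonal_transformation_matrix_vector[OF g(1)] _ _ R P])
  fix i j assume ij: "i < m" "j < n"
  show "integrable lebesgue (\<lambda>x. indicator \<Omega> x *\<^sub>R (q x $ i * (a x * p x $ j)))"
    using wd ij by (simp add: mass_entries_well_defined_def set_integrable_def)
  have "q (g *v x) $ i * (a (g *v x) * p (g *v x) $ j) =
      (\<Sum>k<m. \<Sum>l<n. R $$ (i, k) * P $$ (j, l) * (q x $ k * (a x * p x $ l)))" if x: "x \<in> \<Omega>" for x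
  proof -
    have "q (g *v x) $ i * (a (g *v x) * p (g *v x) $ j) =
        a x * ((\<Sum>k<m. R $$ (i, k) * q x $ k) * (\<Sum>l<n. P $$ (j, l) * p x $ l))"
      using ij by (simp only: a[OF x] q(2)[OF x] p(2)[OF x] index_mult_mat_vec_sum[OF R q(1)[OF x]]
          index_mult_mat_vec_sum[OF P(1) p(1)[OF x]] mult_ac)
    also have "\<dots> = (\<Sum>k<m. \<Sum>l<n. R $$ (i, k) * P $$ (j, l) * (q x $ k * (a x * p x $ l)))"
      by (simp add: sum_product sum_distrib_left mult_ac)
    finally show ?thesis .
  qed
  then show "AE x in lebesgue. indicator \<Omega> (g *v x) *\<^sub>R (q (g *v x) $ i * (a (g *v x) * p (g *v x) $ j)) =
      (\<Sum>k<m. \<Sum>l<n. R $$ (i, k) * P $$ (j, l) * (indicator \<Omega> x *\<^sub>R (q x $ k * (a x * p x $ l))))"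
    by (intro AE_I2) (simp add: indicator_def invariant_set_iff[OF g])
qed

text \<open>
  The two factors \<open>g\<close> in front of the gradients cancel in the inner product because \<open>g\<close> is orthogonal.
\<close>

lemma stiffness_matrix_intertwiner:
  fixes g :: "real ^ 'd ^ 'd"
  assumes g: "orthogonal_matrix g" "(\<lambda>x. g *v x) ` \<Omega> = \<Omega>"
    and q: "\<And>x. x \<in> \<Omega> \<Longrightarrow> q x \<in> carrier_vec m" "\<And>x. x \<in> \<Omega> \<Longrightarrow> q (g *v x) = R *\<^sub>v q x"
    and p: "\<And>x. x \<in> \<Omega> \<Longrightarrow> p x \<in> carrier_vec n" "\<And>x. x \<in> \<Omega> \<Longrightarrow> p (g *v x) = P *\<^sub>v p x"
    and R: "R \<in> carrier_mat m m" and P: "P \<in> carrier_mat n n" "transpose_mat P * P = 1\<^sub>m n"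
    and wd: "stiffness_entries_well_defined \<Omega> m n q p"
  shows "R * stiffness_matrix \<Omega> m n q p = stiffness_matrix \<Omega> m n q p * P"
  unfolding stiffness_matrix_def set_lebesgue_integral_def
proof (rule equivariant_integrals_intertwine[OF orthogonal_transformation_matrix_vector[OF g(1)] _ _ R P])
  let ?dq = "\<lambda>i. gradient_within \<Omega> (\<lambda>y. q y $ i)" and ?dp = "\<lambda>j. gradient_within \<Omega> (\<lambda>y. p y $ j)"
  fix i j assume ij: "i < m" "j < n"
  show "integrable lebesgue (\<lambda>x. indicator \<Omega> x *\<^sub>R (?dq i x \<bullet> ?dp j x))"
    using wd ij by (simp add: stiffness_entries_well_defined_def set_integrable_def)
  have "AE x in lebesgue. \<forall>k\<in>{..<m}. x \<in> \<Omega> \<longrightarrow> (\<exists>!v. has_gradient_within \<Omega> (\<lambda>y. q y $ k) x v)"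
    using wd by (intro AE_finite_allI) (auto simp: stiffness_entries_well_defined_def gradient_well_defined_def)
  moreover have "AE x in lebesgue. \<forall>l\<in>{..<n}. x \<in> \<Omega> \<longrightarrow> (\<exists>!v. has_gradient_within \<Omega> (\<lambda>y. p y $ l) x v)"
    using wd by (intro AE_finite_allI) (auto simp: stiffness_entries_well_defined_def gradient_well_defined_def)
  ultimately show "AE x in lebesgue. indicator \<Omega> (g *v x) *\<^sub>R (?dq i (g *v x) \<bullet> ?dp j (g *v x)) =
      (\<Sum>k<m. \<Sum>l<n. R $$ (i, k) * P $$ (j, l) * (indicator \<Omega> x *\<^sub>R (?dq k x \<bullet> ?dp l x)))"
  proof eventually_elim
    case (elim x)
    show ?case
    proof (cases "x \<in> \<Omega>")
      case True
      have "?dq i (g *v x) = g *v (\<Sum>k<m. R $$ (i, k) *\<^sub>R ?dq k x)"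
        using elim(1) True ij(1)
        by (intro gradient_within_equivariant[OF g]) (simp_all add: q index_mult_mat_vec_sum[OF R])
      moreover have "?dp j (g *v x) = g *v (\<Sum>l<n. P $$ (j, l) *\<^sub>R ?dp l x)"
        using elim(2) True ij(2)
        by (intro gradient_within_equivariant[OF g]) (simp_all add: p index_mult_mat_vec_sum[OF P(1)])
      ultimately have "?dq i (g *v x) \<bullet> ?dp j (g *v x) =
          (\<Sum>k<m. R $$ (i, k) *\<^sub>R ?dq k x) \<bullet> (\<Sum>l<n. P $$ (j, l) *\<^sub>R ?dp l x)"
        using orthogonal_transformation_matrix_vector[OF g(1)] by (simp add: orthogonal_transformation_def)
      also have "\<dots> = (\<Sum>k<m. \<Sum>l<n. R $$ (i, k) * P $$ (j, l) * (?dq k x \<bullet> ?dp l x))"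
        by (simp add: inner_sum_left inner_sum_right sum_distrib_left mult_ac) (rule sum.swap)
      finally show ?thesis using True by (simp add: invariant_set_iff[OF g])
    qed (simp add: invariant_set_iff[OF g])
  qed
qed

section \<open>Schur's lemma for real orthogonal representations\<close>

lemma orthogonal_repD:
  assumes "orthogonal_rep G n \<rho>" and "g \<in> G"
  shows "\<rho> g \<in> carrier_mat n n"
    and "transpose_mat (\<rho> g) * \<rho> g = 1\<^sub>m n"
    and "\<rho> g * transpose_mat (\<rho> g) = 1\<^sub>m n"
proof -
  show c: "\<rho> g \<in> carrier_mat n n" and 1: "transpose_mat (\<rho> g) * \<rho> g = 1\<^sub>m n"
    using assms by (auto simp: orthogonal_rep_def hom_def orthogonal_group_def)
  show "\<rho> g * transpose_mat (\<rho> g) = 1\<^sub>m n"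
    using mat_mult_left_right_inverse[OF _ c 1] c by simp
qed

lemma subspace_mat_kernel:
  assumes A: "(A :: real mat) \<in> carrier_mat m n"
  shows "VectorSpace.subspace class_ring (mat_kernel A) (module_vec TYPE(real) n)"
  unfolding VectorSpace.subspace_def submodule_def
  using vec_vs vec_module A
  by (auto simp: module_vec_simps mat_kernel[OF A] mult_add_distrib_mat_vec[OF A] mult_mat_vec[OF A])

text \<open>
  The kernel is an invariant subspace, so a nonzero vector in it forces it to be the whole space.
\<close>

lemma irreducible_rep_kernel:
  assumes irr: "irreducible_rep G n \<sigma>" and A: "A \<in> carrier_mat m n"
    and inv: "\<And>g v. g \<in> G \<Longrightarrow> v \<in> carrier_vec n \<Longrightarrow> A *\<^sub>v v = 0\<^sub>v m \<Longrightarrow> A *\<^sub>v (\<sigma> g *\<^sub>v v) = 0\<^sub>v m"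
    and v: "v \<in> carrier_vec n" "v \<noteq> 0\<^sub>v n" "A *\<^sub>v v = 0\<^sub>v m"
  shows "A = 0\<^sub>m m n"
proof -
  have rep: "orthogonal_rep G n \<sigma>" using irr by (simp add: irreducible_rep_def)
  have "(\<lambda>v. \<sigma> g *\<^sub>v v) ` mat_kernel A \<subseteq> mat_kernel A" if "g \<in> G" for g
    using inv[OF that] orthogonal_repD(1)[OF rep that] by (auto simp: mat_kernel[OF A])
  with subspace_mat_kernel[OF A] irr
  have "mat_kernel A = {0\<^sub>v n} \<or> mat_kernel A = carrier_vec n"
    unfolding irreducible_rep_def by blast
  moreover have "v \<in> mat_kernel A" using v by (simp add: mat_kernel[OF A])
  ultimately have ker: "mat_kernel A = carrier_vec n" using v by auto
  show ?thesis
  proof (rule eq_matI)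
    fix i j assume ij: "i < dim_row (0\<^sub>m m n)" "j < dim_col (0\<^sub>m m n)"
    then have "unit_vec n j \<in> mat_kernel A" by (simp add: ker)
    then have "A *\<^sub>v unit_vec n j = 0\<^sub>v m" by (simp add: mat_kernel[OF A])
    then have "(A *\<^sub>v unit_vec n j) $ i = 0" using ij by simp
    then show "A $$ (i, j) = 0\<^sub>m m n $$ (i, j)" using A ij by simp
  qed (use A in auto)
qed

text \<open>
  Over the complex numbers an eigenvalue exists; symmetry makes it real, and then it is already a
  root of the real characteristic polynomial.
\<close>

lemma symmetric_mat_real_eigenvector:
  fixes C :: "real mat"
  assumes C: "C \<in> carrier_mat n n" and sym: "transpose_mat C = C" and n: "n > 0"
  obtains l v where "v \<in> carrier_vec n" "v \<noteq> 0\<^sub>v n" "C *\<^sub>v v = l \<cdot>\<^sub>v v"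
proof -
  let ?C = "map_mat complex_of_real C"
  have C': "?C \<in> carrier_mat n n" using C by simp
  have sym': "transpose_mat ?C = ?C" using sym by (simp add: map_mat_transpose)
  obtain k where k: "eigenvalue ?C k"
    using spectrum_non_empty[OF C' n] by (auto simp: spectrum_def)
  then obtain v where v: "v \<in> carrier_vec n" "v \<noteq> 0\<^sub>v n" and kv: "?C *\<^sub>v v = k \<cdot>\<^sub>v v"
    using C' by (auto simp: eigenvalue_def eigenvector_def)
  have conj: "?C *\<^sub>v conjugate v = conjugate (?C *\<^sub>v v)"
    using C v by (intro eq_vecI) (auto simp: scalar_prod_def sum_conjugate)
  have "k * (v \<bullet> conjugate v) = (transpose_mat ?C *\<^sub>v v) \<bullet> conjugate v"
    using v by (simp add: sym' kv)
  also have "\<dots> = v \<bullet> (?C *\<^sub>v conjugate v)"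
    by (rule transpose_vec_mult_scalar[OF C']) (use v in auto)
  also have "\<dots> = cnj k * (v \<bullet> conjugate v)"
    using v by (simp add: conj kv conjugate_smult_vec)
  finally have "k = cnj k"
    using conjugate_square_eq_0_vec[OF v(1)] v(2) by simp
  then obtain l where l: "k = complex_of_real l"
    by (metis Reals_cases Reals_cnj_iff)
  have "poly (char_poly ?C) k = 0" using k eigenvalue_root_char_poly[OF C'] by simp
  then have "poly (char_poly C) l = 0"
    by (simp add: of_real_hom.char_poly_hom[OF C] l)
  then have "eigenvalue C l" using eigenvalue_root_char_poly[OF C] by simp
  then show ?thesis using that C by (auto simp: eigenvalue_def eigenvector_def)
qed

text \<open>
  Real irreducible representations can have commutants larger than the scalars, but a symmetric
  element of the commutant has a real eigenvalue \<open>l\<close>, and \<open>C - l\<close> is then singular, hence zero.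
\<close>

lemma irreducible_rep_symmetric_commutant:
  assumes irr: "irreducible_rep G n \<sigma>" and C: "C \<in> carrier_mat n n"
    and sym: "transpose_mat C = C" and comm: "\<And>g. g \<in> G \<Longrightarrow> \<sigma> g * C = C * \<sigma> g"
  obtains l where "C = l \<cdot>\<^sub>m 1\<^sub>m n"
proof -
  have rep: "orthogonal_rep G n \<sigma>" and n: "n > 0" using irr by (auto simp: irreducible_rep_def)
  obtain l v where v: "v \<in> carrier_vec n" "v \<noteq> 0\<^sub>v n" and lv: "C *\<^sub>v v = l \<cdot>\<^sub>v v"
    using symmetric_mat_real_eigenvector[OF C sym n] .
  let ?A = "C - l \<cdot>\<^sub>m 1\<^sub>m n"
  have A: "?A \<in> carrier_mat n n" using C by auto
  have "?A = 0\<^sub>m n n"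
  proof (rule irreducible_rep_kernel[OF irr A])
    fix g v assume g: "g \<in> G" and v: "v \<in> carrier_vec n" and Av: "?A *\<^sub>v v = 0\<^sub>v n"
    note sg = orthogonal_repD(1)[OF rep g]
    have "?A * \<sigma> g = \<sigma> g * ?A"
      using C sg by (simp add: minus_mult_distrib_mat mult_minus_distrib_mat comm[OF g]
          mult_smult_distrib[OF sg one_carrier_mat] mult_smult_assoc_mat[of _ n n])
    then have "?A *\<^sub>v (\<sigma> g *\<^sub>v v) = \<sigma> g *\<^sub>v (?A *\<^sub>v v)"
      using A sg v by (simp flip: assoc_mult_mat_vec)
    then show "?A *\<^sub>v (\<sigma> g *\<^sub>v v) = 0\<^sub>v n" using sg by (auto simp: Av)
  next
    show "?A *\<^sub>v v = 0\<^sub>v n"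
    proof -
      have "(l \<cdot>\<^sub>m 1\<^sub>m n) *\<^sub>v v = l \<cdot>\<^sub>v v"
        using v by (intro eq_vecI) (auto simp: scalar_prod_def mult.assoc mult_delta_left mult_delta_right)
      then show ?thesis
        using C v by (simp add: minus_mult_distrib_mat_vec[of _ n n] lv)
    qed
  qed (use v in auto)
  then have "?A $$ (i, j) = 0" if "i < n" "j < n" for i j
    using that by simp
  then have "C = l \<cdot>\<^sub>m 1\<^sub>m n"
    using C by (intro eq_matI) simp_all
  then show ?thesis by (rule that)
qed

text \<open>
  Transposition turns \<open>\<rho> g\<close> into its inverse, so the relation can be rearranged at the same \<open>g\<close>,
  without passing to the inverse group element.
\<close>

lemma transpose_intertwiner:
  assumes rep: "orthogonal_rep G m \<rho>" "orthogonal_rep G n \<rho>'" and B: "B \<in> carrier_mat m n"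
    and g: "g \<in> G" and comm: "\<rho> g * B = B * \<rho>' g"
  shows "\<rho>' g * transpose_mat B = transpose_mat B * \<rho> g"
proof -
  note r = orthogonal_repD[OF rep(1) g] and r' = orthogonal_repD[OF rep(2) g]
  let ?B = "transpose_mat B" and ?r = "transpose_mat (\<rho> g)" and ?r' = "transpose_mat (\<rho>' g)"
  have c: "?B \<in> carrier_mat n m" "?r \<in> carrier_mat m m" "?r' \<in> carrier_mat n n"
    using B r(1) r'(1) by auto
  have *: "?B * ?r = ?r' * ?B"
    using arg_cong[OF comm, of transpose_mat] transpose_mult[OF r(1) B] transpose_mult[OF B r'(1)] by simp
  have "\<rho>' g * ?B = \<rho>' g * (?B * (?r * \<rho> g))"
    using c by (simp add: r)
  also have "\<dots> = \<rho>' g * ((?B * ?r) * \<rho> g)"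
    using c r(1) by (simp add: assoc_mult_mat[OF c(1,2) r(1)])
  also have "\<dots> = \<rho>' g * (?r' * (?B * \<rho> g))"
    unfolding * by (simp add: assoc_mult_mat[OF c(3,1) r(1)])
  also have "\<dots> = (\<rho>' g * ?r') * (?B * \<rho> g)"
    using c r(1) r'(1) by (intro assoc_mult_mat[symmetric]) auto
  also have "\<dots> = ?B * \<rho> g"
    using c r(1) by (simp add: r'(3))
  finally show ?thesis .
qed

lemma irreducible_reps_intertwiner_gram:
  assumes irr: "irreducible_rep G m \<rho>" "irreducible_rep G n \<rho>'" and B: "B \<in> carrier_mat m n"
    and comm: "\<And>g. g \<in> G \<Longrightarrow> \<rho> g * B = B * \<rho>' g"
  obtains l where "transpose_mat B * B = l \<cdot>\<^sub>m 1\<^sub>m n"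
proof (rule irreducible_rep_symmetric_commutant[OF irr(2)])
  have rep: "orthogonal_rep G m \<rho>" "orthogonal_rep G n \<rho>'"
    using irr by (auto simp: irreducible_rep_def)
  have Bt: "transpose_mat B \<in> carrier_mat n m" using B by simp
  show "transpose_mat B * B \<in> carrier_mat n n" using B by simp
  show "transpose_mat (transpose_mat B * B) = transpose_mat B * B"
    using transpose_mult[OF Bt B] by simp
  fix g assume g: "g \<in> G"
  note r = orthogonal_repD(1)[OF rep(1) g] and r' = orthogonal_repD(1)[OF rep(2) g]
  have "\<rho>' g * (transpose_mat B * B) = (transpose_mat B * \<rho> g) * B"
    by (simp add: assoc_mult_mat[OF r' Bt B, symmetric] transpose_intertwiner[OF rep B g comm[OF g]])
  also have "\<dots> = transpose_mat B * B * \<rho>' g"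
    by (simp add: assoc_mult_mat[OF Bt r B] comm[OF g] assoc_mult_mat[OF Bt B r'])
  finally show "\<rho>' g * (transpose_mat B * B) = transpose_mat B * B * \<rho>' g" .
qed (use that in auto)

text \<open>
  The notion of isomorphism asks for an orthogonal conjugating matrix, so invertibility of \<open>B\<close> would
  not be enough.  Both Gram matrices \<open>B\<^sup>T B\<close> and \<open>B B\<^sup>T\<close> lie in a commutant and are symmetric,
  hence scalar, with the same scalar \<open>l > 0\<close>.  Comparing their traces gives \<open>m = n\<close>, and
  \<open>B / sqrt l\<close> is orthogonal.
\<close>

lemma schur_isomorphic:
  assumes irr: "irreducible_rep G m \<rho>" "irreducible_rep G n \<rho>'" and B: "B \<in> carrier_mat m n"
    and comm: "\<And>g. g \<in> G \<Longrightarrow> \<rho> g * B = B * \<rho>' g" and "B \<noteq> 0\<^sub>m m n"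
  shows "isomorphic_reps G m \<rho> n \<rho>'"
proof -
  have rep: "orthogonal_rep G m \<rho>" "orthogonal_rep G n \<rho>'"
    using irr by (auto simp: irreducible_rep_def)
  have Bt: "transpose_mat B \<in> carrier_mat n m" using B by simp
  obtain l where l: "transpose_mat B * B = l \<cdot>\<^sub>m 1\<^sub>m n"
    using irreducible_reps_intertwiner_gram[OF irr B comm] .
  obtain l' where "transpose_mat (transpose_mat B) * transpose_mat B = l' \<cdot>\<^sub>m 1\<^sub>m m"
    using irreducible_reps_intertwiner_gram[OF irr(2,1) Bt transpose_intertwiner[OF rep B _ comm]] .
  then have l': "B * transpose_mat B = l' \<cdot>\<^sub>m 1\<^sub>m m" by simp
  obtain i j where ij: "i < m" "j < n" "B $$ (i, j) \<noteq> 0"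
    using B \<open>B \<noteq> 0\<^sub>m m n\<close> by (metis carrier_matD eq_matI index_zero_mat)
  have col: "l = (\<Sum>k<m. (B $$ (k, j))\<^sup>2)" if "j < n" for j
    using arg_cong[OF l, of "\<lambda>A. A $$ (j, j)"] B that
    by (simp add: scalar_prod_def power2_eq_square atLeast0LessThan)
  have row: "l' = (\<Sum>k<n. (B $$ (i, k))\<^sup>2)" if "i < m" for i
    using arg_cong[OF l', of "\<lambda>A. A $$ (i, i)"] B that
    by (simp add: scalar_prod_def power2_eq_square atLeast0LessThan)
  have pos: "l > 0"
    using ij by (subst col[OF ij(2)]) (auto intro!: sum_pos2[of _ i])
  \<comment> \<open>The two scalars agree because \<open>B B\<^sup>T B\<close> can be bracketed in two ways.\<close>
  have "l' \<cdot>\<^sub>m B = (B * transpose_mat B) * B"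
    using B by (simp add: l' mult_smult_assoc_mat[OF one_carrier_mat B])
  also have "\<dots> = l \<cdot>\<^sub>m B"
    using B by (simp add: assoc_mult_mat[OF B Bt B] l mult_smult_distrib[OF B one_carrier_mat])
  finally have "l' * B $$ (i, j) = l * B $$ (i, j)"
    using B ij by (metis carrier_matD index_smult_mat(1))
  with ij have "l' = l" by simp
  have "real n * l = (\<Sum>j<n. \<Sum>k<m. (B $$ (k, j))\<^sup>2)"
    by (simp add: col[symmetric])
  also have "\<dots> = (\<Sum>k<m. \<Sum>j<n. (B $$ (k, j))\<^sup>2)" by (rule sum.swap)
  also have "\<dots> = real m * l" by (simp add: row[symmetric] \<open>l' = l\<close>)
  finally have mn: "m = n" using pos by simp
  define c where "c = 1 / sqrt l"
  have c: "c * (c * l) = 1" using pos by (simp add: c_def)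
  define Q where "Q = c \<cdot>\<^sub>m B"
  have Q: "Q \<in> carrier_mat n n" using B by (simp add: Q_def mn)
  have "transpose_mat Q * Q = (c \<cdot>\<^sub>m transpose_mat B) * (c \<cdot>\<^sub>m B)"
    unfolding Q_def by (intro arg_cong2[of _ _ _ _ "(*)"] eq_matI) auto
  also have "\<dots> = c \<cdot>\<^sub>m (c \<cdot>\<^sub>m (l \<cdot>\<^sub>m 1\<^sub>m n))"
    using B by (simp add: mult_smult_distrib[of _ n m] mult_smult_assoc_mat[of _ n m] l)
  also have "\<dots> = 1\<^sub>m n"
    using c by (intro eq_matI) auto
  finally have QQ: "transpose_mat Q * Q = 1\<^sub>m n" .
  have "\<rho>' g = transpose_mat Q * \<rho> g * Q" if g: "g \<in> G" for g
  proof -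
    note r = orthogonal_repD(1)[OF rep(1) g] and r' = orthogonal_repD(1)[OF rep(2) g]
    have "\<rho> g * Q = Q * \<rho>' g"
      using B r r' by (simp add: Q_def mult_smult_distrib[OF r B] mult_smult_assoc_mat[OF B r'] comm[OF g])
    then have "transpose_mat Q * \<rho> g * Q = transpose_mat Q * (Q * \<rho>' g)"
      using Q r mn by (simp add: assoc_mult_mat[of _ n n _ n _ n])
    also have "\<dots> = (transpose_mat Q * Q) * \<rho>' g"
      using Q r' by (simp add: assoc_mult_mat[of _ n n _ n _ n])
    finally show ?thesis using r' by (simp add: QQ)
  qed
  then show ?thesis
    unfolding isomorphic_reps_def orthogonal_group_def using mn Q QQ by auto
qed

section \<open>Intertwiners of direct sums\<close>

lemma four_block_mult_append_rows:
  assumes "A \<in> carrier_mat a a" "D \<in> carrier_mat d d" "X \<in> carrier_mat a e" "Y \<in> carrier_mat d e"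
  shows "four_block_mat A (0\<^sub>m a d) (0\<^sub>m d a) D * (X @\<^sub>r Y) = (A * X) @\<^sub>r (D * (Y :: real mat))"
  using assms
  by (simp add: append_rows_def mult_four_block_mat[of _ a a _ d _ d _ _ e _ 0])

lemma append_rows_mult:
  assumes "X \<in> carrier_mat a e" "Y \<in> carrier_mat d e" "S \<in> carrier_mat e f"
  shows "(X @\<^sub>r Y) * S = (X * S) @\<^sub>r (Y * (S :: real mat))"
proof (rule eq_matI)
  fix i j assume "i < dim_row ((X * S) @\<^sub>r (Y * S))" "j < dim_col ((X * S) @\<^sub>r (Y * S))"
  then have "i < a + d" "j < f" using assms by (auto simp: append_rows_def)
  then show "((X @\<^sub>r Y) * S) $$ (i, j) = ((X * S) @\<^sub>r (Y * S)) $$ (i, j)"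
    using assms by (auto simp: append_rows_def scalar_prod_def)
qed (use assms in \<open>auto simp: append_rows_def\<close>)

lemma transpose_diag_block_mat:
  "transpose_mat (diag_block_mat As) = diag_block_mat (map transpose_mat As)"
proof (induction As)
  case (Cons A As)
  let ?D = "diag_block_mat As"
  have "?D \<in> carrier_mat (dim_row ?D) (dim_col ?D)" "A \<in> carrier_mat (dim_row A) (dim_col A)" by auto
  then show ?case
    using Cons.IH transpose_four_block_mat[of A "dim_row A" "dim_col A" "0\<^sub>m (dim_row A) (dim_col ?D)"
        "dim_col ?D" "0\<^sub>m (dim_row ?D) (dim_col A)" "dim_row ?D" ?D]
    by (simp add: Let_def dim_diag_block_mat o_def Cons.IH)
qed simp

text \<open>
  The matrix \<open>E\<close> embeds the block containing position \<open>s\<close> into the direct sum.  It depends only on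
  the block sizes and works for every family \<open>S\<close> of blocks.  This uniformity lets the same \<open>E\<close> be
  used for a family and for its transposes, which yields the relation for the projection
  \<open>E\<^sup>T\<close> as well.
\<close>

lemma component_inclusion:
  fixes us :: "'i list"
  assumes "s < sum_list (map dims us)"
    and "concat (map (\<lambda>i. map (Pair i) [0..<dims i]) us) ! s = (i, k)"
  shows "i \<in> set us \<and> k < dims i \<and>
    (\<exists>E \<in> carrier_mat (sum_list (map dims us)) (dims i).
       col E k = unit_vec (sum_list (map dims us)) s \<and>
       (\<forall>S. (\<forall>i \<in> set us. S i \<in> carrier_mat (dims i) (dims i)) \<longrightarrow>
          diag_block_mat (map S us) * E = E * (S i :: real mat)))"
  using assms
proof (induction us arbitrary: s)
  case (Cons u us)
  let ?d = "dims u" and ?N = "sum_list (map dims us)"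
  have dim: "diag_block_mat (map S us) \<in> carrier_mat ?N ?N"
    if "\<forall>i \<in> set us. S i \<in> carrier_mat (dims i) (dims i)" for S :: "'i \<Rightarrow> real mat"
    by (intro carrier_matI) (simp_all add: dim_diag_block_mat o_def carrier_matD[OF that[rule_format]] cong: map_cong)
  have D: "diag_block_mat (map S (u # us)) =
      four_block_mat (S u) (0\<^sub>m ?d ?N) (0\<^sub>m ?N ?d) (diag_block_mat (map S us))"
    if "\<forall>i \<in> set (u # us). S i \<in> carrier_mat (dims i) (dims i)" for S :: "'i \<Rightarrow> real mat"
    using that dim[of S] by (auto simp: Let_def)
  show ?case
  proof (cases "s < ?d")
    case True
    then have [simp]: "i = u" "k = s" using Cons.prems by (simp_all add: nth_append)
    let ?E = "1\<^sub>m ?d @\<^sub>r 0\<^sub>m ?N ?d :: real mat"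
    have "col ?E s = unit_vec (?d + ?N) s"
      using True by (intro eq_vecI) (auto simp: append_rows_def)
    moreover have "diag_block_mat (map S (u # us)) * ?E = ?E * S u"
      if S: "\<forall>i \<in> set (u # us). S i \<in> carrier_mat (dims i) (dims i)" for S :: "'i \<Rightarrow> real mat"
    proof -
      have "diag_block_mat (map S (u # us)) * ?E =
          (S u * 1\<^sub>m ?d) @\<^sub>r (diag_block_mat (map S us) * 0\<^sub>m ?N ?d)"
        unfolding D[OF S] using S by (intro four_block_mult_append_rows dim) auto
      also have "\<dots> = (1\<^sub>m ?d * S u) @\<^sub>r (0\<^sub>m ?N ?d * S u)"
        using S dim[of S] left_mult_one_mat[of "S u" ?d ?d] right_mult_one_mat[of "S u" ?d ?d]
          left_mult_zero_mat[of "S u" ?d ?d ?N] by simp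
      also have "\<dots> = ?E * S u"
        using S by (intro append_rows_mult[symmetric]) auto
      finally show ?thesis .
    qed
    ultimately show ?thesis using True by (auto intro!: bexI[of _ ?E])
  next
    case False
    then have "s - ?d < ?N" "concat (map (\<lambda>i. map (Pair i) [0..<dims i]) us) ! (s - ?d) = (i, k)"
      using Cons.prems by (simp_all add: nth_append)
    from Cons.IH[OF this] obtain E :: "real mat" where i: "i \<in> set us" "k < dims i"
      and E: "E \<in> carrier_mat ?N (dims i)" and col: "col E k = unit_vec ?N (s - ?d)"
      and DE: "\<And>S. \<forall>i \<in> set us. S i \<in> carrier_mat (dims i) (dims i) \<Longrightarrow>
          diag_block_mat (map S us) * E = E * S i"
      by blast
    let ?E = "0\<^sub>m ?d (dims i) @\<^sub>r E"
    have "col ?E k = unit_vec (?d + ?N) s"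
    proof (rule eq_vecI)
      fix x assume x: "x < dim_vec (unit_vec (?d + ?N) s)"
      have "E $$ (x - ?d, k) = unit_vec ?N (s - ?d) $ (x - ?d)" if "\<not> x < ?d"
        using that x E i by (simp flip: col)
      then show "col ?E k $ x = unit_vec (?d + ?N) s $ x"
        using x E i False \<open>s - ?d < ?N\<close> by (auto simp: append_rows_def)
    qed (use E in \<open>simp add: append_rows_def\<close>)
    moreover have "diag_block_mat (map S (u # us)) * ?E = ?E * S i"
      if S: "\<forall>i \<in> set (u # us). S i \<in> carrier_mat (dims i) (dims i)" for S :: "'i \<Rightarrow> real mat"
    proof -
      have "diag_block_mat (map S (u # us)) * ?E =
          (S u * 0\<^sub>m ?d (dims i)) @\<^sub>r (diag_block_mat (map S us) * E)"
        unfolding D[OF S] using S E by (intro four_block_mult_append_rows dim) auto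
      also have "\<dots> = (0\<^sub>m ?d (dims i) * S i) @\<^sub>r (E * S i)"
        using S i right_mult_zero_mat[of "S u" ?d ?d "dims i"] left_mult_zero_mat[of "S i" "dims i" "dims i" ?d]
        by (simp add: DE)
      also have "\<dots> = ?E * S i"
        using S E i by (intro append_rows_mult[symmetric]) auto
      finally show ?thesis .
    qed
    ultimately show ?thesis using E i by (auto intro!: bexI[of _ ?E])
  qed
qed simp

text \<open>
  Compressing \<open>M\<close> between the inclusions of two blocks gives an intertwiner of the two
  representations, and the given entry of \<open>M\<close> reappears in it.
\<close>

lemma intertwiner_component:
  fixes M :: "real mat" and dims :: "'i \<Rightarrow> nat" and \<sigma> :: "'i \<Rightarrow> 'g \<Rightarrow> real mat"
  defines "types \<equiv> \<lambda>us. concat (map (\<lambda>i. map (Pair i) [0..<dims i]) us)"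
  assumes \<sigma>: "\<And>i g. i \<in> set us \<union> set vs \<Longrightarrow> g \<in> G \<Longrightarrow> \<sigma> i g \<in> carrier_mat (dims i) (dims i)"
    and M: "M \<in> carrier_mat (sum_list (map dims us)) (sum_list (map dims vs))"
    and comm: "\<And>g. g \<in> G \<Longrightarrow>
      diag_block_mat (map (\<lambda>i. \<sigma> i g) us) * M = M * diag_block_mat (map (\<lambda>i. \<sigma> i g) vs)"
    and s: "s < sum_list (map dims us)" "types us ! s = (i, k)"
    and t: "t < sum_list (map dims vs)" "types vs ! t = (j, l)"
  obtains B where "B \<in> carrier_mat (dims i) (dims j)" "B $$ (k, l) = M $$ (s, t)"
    "\<And>g. g \<in> G \<Longrightarrow> \<sigma> i g * B = B * \<sigma> j g"
proof -
  let ?m = "sum_list (map dims us)" and ?n = "sum_list (map dims vs)"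
  let ?D = "\<lambda>us g. diag_block_mat (map (\<lambda>i. \<sigma> i g) us)"
  obtain E :: "real mat" where i: "i \<in> set us" "k < dims i" and E: "E \<in> carrier_mat ?m (dims i)"
    and colE: "col E k = unit_vec ?m s"
    and DE: "\<And>S. \<forall>i \<in> set us. S i \<in> carrier_mat (dims i) (dims i) \<Longrightarrow>
          diag_block_mat (map S us) * E = E * S i"
    using component_inclusion[OF s[unfolded types_def]] by auto
  obtain F :: "real mat" where j: "j \<in> set vs" "l < dims j" and F: "F \<in> carrier_mat ?n (dims j)"
    and colF: "col F l = unit_vec ?n t"
    and DF: "\<And>S. \<forall>i \<in> set vs. S i \<in> carrier_mat (dims i) (dims i) \<Longrightarrow>
          diag_block_mat (map S vs) * F = F * S j"
    using component_inclusion[OF t[unfolded types_def]] by auto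
  have D: "?D us g \<in> carrier_mat ?m ?m" "?D vs g \<in> carrier_mat ?n ?n" if "g \<in> G" for g
    by (intro carrier_matI; simp add: dim_diag_block_mat o_def carrier_matD[OF \<sigma>[OF _ that]] cong: map_cong)+
  have Et: "transpose_mat E \<in> carrier_mat (dims i) ?m" using E by simp
  define B where "B = transpose_mat E * M * F"
  show ?thesis
  proof
    show "B \<in> carrier_mat (dims i) (dims j)" using E M F by (simp add: B_def)
    have "B $$ (k, l) = row (transpose_mat E) k \<bullet> col (M * F) l"
      using E M F i j by (simp add: B_def assoc_mult_mat[OF Et M F])
    also have "\<dots> = unit_vec ?m s \<bullet> (M *\<^sub>v unit_vec ?n t)"
      using E i by (simp add: col_mult2[OF M F j(2)] colE colF)
    also have "\<dots> = M $$ (s, t)" using M s t by simp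
    finally show "B $$ (k, l) = M $$ (s, t)" .
    fix g assume g: "g \<in> G"
    have \<sigma>i: "\<sigma> i g \<in> carrier_mat (dims i) (dims i)" and \<sigma>j: "\<sigma> j g \<in> carrier_mat (dims j) (dims j)"
      using \<sigma>[OF _ g] i j by auto
    have "transpose_mat (?D us g) * E = E * transpose_mat (\<sigma> i g)"
      using DE[of "\<lambda>i. transpose_mat (\<sigma> i g)"] \<sigma>[OF _ g] by (simp add: transpose_diag_block_mat o_def)
    from arg_cong[OF this, of transpose_mat] have ED: "transpose_mat E * ?D us g = \<sigma> i g * transpose_mat E"
      using transpose_mult[OF _ E, of "transpose_mat (?D us g)"] transpose_mult[OF E, of "transpose_mat (\<sigma> i g)"]
        D(1)[OF g] \<sigma>i by simp
    have DFg: "?D vs g * F = F * \<sigma> j g"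
      using DF[of "\<lambda>i. \<sigma> i g"] \<sigma>[OF _ g] by simp
    have EtM: "transpose_mat E * M \<in> carrier_mat (dims i) ?n" using Et M by simp
    have "\<sigma> i g * (transpose_mat E * M) = \<sigma> i g * transpose_mat E * M"
      by (rule assoc_mult_mat[OF \<sigma>i Et M, symmetric])
    also have "\<dots> = transpose_mat E * (?D us g * M)"
      unfolding ED[symmetric] by (rule assoc_mult_mat[OF Et D(1)[OF g] M])
    also have "\<dots> = transpose_mat E * M * ?D vs g"
      unfolding comm[OF g] by (rule assoc_mult_mat[OF Et M D(2)[OF g], symmetric])
    finally have EtM_comm: "\<sigma> i g * (transpose_mat E * M) = transpose_mat E * M * ?D vs g" .
    have "\<sigma> i g * B = \<sigma> i g * (transpose_mat E * M) * F"
      unfolding B_def by (rule assoc_mult_mat[OF \<sigma>i EtM F, symmetric])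
    also have "\<dots> = transpose_mat E * M * (?D vs g * F)"
      unfolding EtM_comm by (rule assoc_mult_mat[OF EtM D(2)[OF g] F])
    also have "\<dots> = B * \<sigma> j g"
      unfolding DFg B_def by (rule assoc_mult_mat[OF EtM F \<sigma>j, symmetric])
    finally show "\<sigma> i g * B = B * \<sigma> j g" .
  qed
qed

section \<open>Sorting rows and columns into blocks\<close>

lemma block_of_Cons:
  assumes "s < sum_list (n # ns)"
  shows "block_of (n # ns) s = (if s < n then 0 else Suc (block_of ns (s - n)))"
proof (cases "s < n")
  case True
  then show ?thesis unfolding block_of_def by (simp add: Least_eq_0)
next
  case False
  have "\<exists>b. s < sum_list (take (Suc b) (n # ns))"
    using assms by (intro exI[of _ "length ns"]) simp
  then obtain b where "s < sum_list (take (Suc b) (n # ns))" ..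
  then have "block_of (n # ns) s = Suc (LEAST b. s < sum_list (take (Suc (Suc b)) (n # ns)))"
    unfolding block_of_def by (rule Least_Suc) (use False in simp)
  also have "(\<lambda>b. s < sum_list (take (Suc (Suc b)) (n # ns))) = (\<lambda>b. s - n < sum_list (take (Suc b) ns))"
    using False by auto
  finally show ?thesis using False by (simp add: block_of_def)
qed

lemma concat_nth_in_block:
  assumes "s < length (concat ls)"
  shows "block_of (map length ls) s < length ls \<and> concat ls ! s \<in> set (ls ! block_of (map length ls) s)"
  using assms
proof (induction ls arbitrary: s)
  case (Cons l ls)
  then have eq: "block_of (map length (l # ls)) s =
      (if s < length l then 0 else Suc (block_of (map length ls) (s - length l)))"
    by (simp add: length_concat block_of_Cons)
  show ?case
  proof (cases "s < length l")
    case True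
    then show ?thesis unfolding eq by (simp add: nth_append)
  next
    case False
    then have "s - length l < length (concat ls)" using Cons.prems by simp
    from Cons.IH[OF this] show ?thesis using False unfolding eq by (simp add: nth_append)
  qed
qed simp

text \<open>
  The list of block sizes may contain zeros on either side; peeling off one block at a time treats
  these like any other block.
\<close>

lemma block_diagonalI_block_of:
  assumes "length rs = length cs" and "A \<in> carrier_mat (sum_list rs) (sum_list cs)"
    and "\<And>s t. s < sum_list rs \<Longrightarrow> t < sum_list cs \<Longrightarrow> block_of rs s \<noteq> block_of cs t \<Longrightarrow> A $$ (s, t) = 0"
  shows "block_diagonal rs cs A"
  using assms
proof (induction rs cs arbitrary: A rule: list_induct2)
  case Nil
  then have "A = 0\<^sub>m 0 0" by auto
  then show ?case by (simp add: block_diagonal_def)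
next
  case (Cons r rs c cs)
  let ?B = "Matrix.mat r c (\<lambda>(i, j). A $$ (i, j))"
  let ?A = "Matrix.mat (sum_list rs) (sum_list cs) (\<lambda>(i, j). A $$ (i + r, j + c))"
  have zero: "A $$ (s, t) = 0" if "s < r + sum_list rs" "t < c + sum_list cs"
      "(if s < r then 0 else Suc (block_of rs (s - r))) \<noteq> (if t < c then 0 else Suc (block_of cs (t - c)))"
    for s t
    using Cons.prems(2)[of s t] that by (simp add: block_of_Cons)
  have "block_diagonal rs cs ?A"
    by (rule Cons.IH) (auto intro!: zero)
  then obtain Bs where Bs: "?A = diag_block_mat Bs" "map dim_row Bs = rs" "map dim_col Bs = cs"
    unfolding block_diagonal_def by auto
  have "A = four_block_mat ?B (0\<^sub>m r (sum_list cs)) (0\<^sub>m (sum_list rs) c) ?A"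
    using Cons.prems(1) by (intro eq_matI) (auto intro!: zero)
  then have "A = diag_block_mat (?B # Bs)"
    by (simp add: Let_def Bs(1)[symmetric])
  then show ?case
    unfolding block_diagonal_def using Bs(2,3) by (intro exI[of _ "?B # Bs"]) simp
qed

lemma distinct_concat_filter:
  "distinct (concat (map (\<lambda>b. filter (\<lambda>s. f s = b) [0..<m]) [0..<L]))"
  by (induction L) auto

text \<open>
  The permutation lists the positions with key \<open>0\<close>, then those with key \<open>1\<close>, and so on.  Every key below
  \<open>L\<close> gets a block, possibly empty, so that the block numbers are the keys themselves and two
  such sortings (of the rows and of the columns) are automatically aligned.
\<close>

lemma sort_by_key:
  assumes "\<And>s. s < m \<Longrightarrow> f s < L"
  obtains \<pi> rs where "\<pi> permutes {..<m}" "length rs = L" "sum_list rs = m"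
    "\<And>s. s < m \<Longrightarrow> block_of rs s = f (\<pi> s)"
proof -
  define ls where "ls = map (\<lambda>b. filter (\<lambda>s. f s = b) [0..<m]) [0..<L]"
  define xs where "xs = concat ls"
  have set: "set xs = {..<m}" using assms by (auto simp: xs_def ls_def)
  have dist: "distinct xs" unfolding xs_def ls_def by (rule distinct_concat_filter)
  have len: "length xs = m" using distinct_card[OF dist] set by simp
  define \<pi> where "\<pi> s = (if s < m then xs ! s else s)" for s
  have "bij_betw ((!) xs) {..<m} {..<m}"
    using bij_betw_nth[OF dist refl refl] by (simp only: set len)
  then have "bij_betw \<pi> {..<m} {..<m}"
    by (rule bij_betw_cong[THEN iffD1, rotated]) (simp add: \<pi>_def)
  then have perm: "\<pi> permutes {..<m}"
    by (rule bij_imp_permutes) (simp add: \<pi>_def)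
  have "block_of (map length ls) s = f (\<pi> s)" if "s < m" for s
  proof -
    define b where "b = block_of (map length ls) s"
    have "b < L" "xs ! s \<in> set (ls ! b)"
      using concat_nth_in_block[of s ls] that len by (simp_all add: b_def xs_def) (simp add: ls_def)
    then have "f (xs ! s) = b" by (simp add: ls_def)
    then show ?thesis using that by (simp add: b_def \<pi>_def)
  qed
  moreover have "length (map length ls) = L" "sum_list (map length ls) = m"
    using len by (simp_all add: xs_def length_concat) (simp add: ls_def)
  ultimately show ?thesis using that[OF perm] by blast
qed

lemma block_diagonal_permute_mat:
  assumes "\<pi> permutes {..<m}" "\<tau> permutes {..<n}" "length rs = length cs" "sum_list rs = m" "sum_list cs = n"
    and \<pi>: "\<And>s. s < m \<Longrightarrow> block_of rs s = f (\<pi> s)" and \<tau>: "\<And>t. t < n \<Longrightarrow> block_of cs t = h (\<tau> t)"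
    and A: "A \<in> carrier_mat m n"
    and zero: "\<And>s t. s < m \<Longrightarrow> t < n \<Longrightarrow> f s \<noteq> h t \<Longrightarrow> A $$ (s, t) = 0"
  shows "block_diagonal rs cs (permute_mat \<pi> \<tau> A)"
proof (rule block_diagonalI_block_of)
  fix s t assume st: "s < sum_list rs" "t < sum_list cs" "block_of rs s \<noteq> block_of cs t"
  then have "\<pi> s < m" "\<tau> t < n"
    using assms permutes_in_image[OF assms(1), of s] permutes_in_image[OF assms(2), of t] by auto
  then show "permute_mat \<pi> \<tau> A $$ (s, t) = 0"
    using st assms by (simp add: permute_mat_def)
qed (use assms in \<open>auto simp: permute_mat_def\<close>)

section \<open>Symmetry types and the block structure\<close>

text \<open>
  The direct summands of an adapted representation in order, so that matrices and symmetry
  types are read off from one list.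
\<close>

definition irrep_copies :: "nat \<Rightarrow> (nat \<Rightarrow> nat) \<Rightarrow> nat list" where
  "irrep_copies r \<mu> = concat (map (\<lambda>i. replicate (\<mu> i) i) [0..<r])"

lemma adapted_rep_irrep_copies:
  "adapted_rep r \<sigma> \<mu> g = diag_block_mat (map (\<lambda>i. \<sigma> i g) (irrep_copies r \<mu>))"
  by (simp add: adapted_rep_def irrep_copies_def map_concat o_def)

lemma symmetry_types_irrep_copies:
  "symmetry_types r dims \<mu> = concat (map (\<lambda>i. map (Pair i) [0..<dims i]) (irrep_copies r \<mu>))"
proof -
  have "concat (map (\<lambda>i. concat (replicate (\<mu> i) (f i))) xs) =
      concat (map f (concat (map (\<lambda>i. replicate (\<mu> i) i) xs)))" for f :: "nat \<Rightarrow> 'z list" and xs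
    by (induction xs) simp_all
  then show ?thesis unfolding symmetry_types_def irrep_copies_def .
qed

lemma symmetry_types_bounds:
  assumes "(i, k) \<in> set (symmetry_types r dims \<mu>)"
  shows "i < r" "k < dims i"
  using assms by (auto simp: symmetry_types_def)

lemma length_symmetry_types:
  assumes canon: "canonical_irreps G r dims \<sigma>" and rep: "orthogonal_rep G N (adapted_rep r \<sigma> \<mu>)"
    and g: "g \<in> G"
  shows "length (symmetry_types r dims \<mu>) = N"
proof -
  have "dim_row (\<sigma> i g) = dims i" if "i \<in> set (irrep_copies r \<mu>)" for i
    using canon that orthogonal_repD(1)[OF _ g]
    by (auto simp: canonical_irreps_def irreducible_rep_def irrep_copies_def)
  then have "dim_row (adapted_rep r \<sigma> \<mu> g) = length (symmetry_types r dims \<mu>)"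
    by (simp add: adapted_rep_irrep_copies symmetry_types_irrep_copies dim_diag_block_mat length_concat o_def
        cong: map_cong)
  then show ?thesis using orthogonal_repD(1)[OF rep g] by simp
qed

text \<open>
  Schur's lemma entry by entry: inequivalent representations have no nonzero intertwiner, and a
  self-intertwiner of a representation with scalar commutant is a multiple of the identity, so it
  does not mix components.
\<close>

lemma intertwiner_nonzero_entry:
  assumes canon: "canonical_irreps G r dims \<sigma>"
    and M: "M \<in> carrier_mat (length (symmetry_types r dims \<mu>)) (length (symmetry_types r dims \<nu>))"
    and comm: "\<And>g. g \<in> G \<Longrightarrow> adapted_rep r \<sigma> \<mu> g * M = M * adapted_rep r \<sigma> \<nu> g"
    and s: "s < length (symmetry_types r dims \<mu>)" "symmetry_types r dims \<mu> ! s = (i, k)"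
    and t: "t < length (symmetry_types r dims \<nu>)" "symmetry_types r dims \<nu> ! t = (j, l)"
    and nonzero: "M $$ (s, t) \<noteq> 0"
  shows "i = j \<and> (scalar_commutant G (dims i) (\<sigma> i) \<longrightarrow> k = l)"
proof -
  have irr: "irreducible_rep G (dims i) (\<sigma> i)" if "i < r" for i
    using canon that by (simp add: canonical_irreps_def)
  have carr: "\<sigma> i g \<in> carrier_mat (dims i) (dims i)" if "i < r" "g \<in> G" for i g
    using irr[OF that(1)] orthogonal_repD(1) that(2) by (auto simp: irreducible_rep_def)
  have len: "length (symmetry_types r dims \<mu>) = sum_list (map dims (irrep_copies r \<mu>))" for \<mu>
    by (simp add: symmetry_types_irrep_copies length_concat o_def)
  have ik: "i < r" "k < dims i" and jl: "j < r" "l < dims j"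
    using symmetry_types_bounds nth_mem s t by metis+
  have carr': "\<sigma> i g \<in> carrier_mat (dims i) (dims i)"
    if "i \<in> set (irrep_copies r \<mu>) \<union> set (irrep_copies r \<nu>)" "g \<in> G" for i g
    using that by (intro carr) (auto simp: irrep_copies_def)
  obtain B where B: "B \<in> carrier_mat (dims i) (dims j)" "B $$ (k, l) = M $$ (s, t)"
    and comm_B: "\<And>g. g \<in> G \<Longrightarrow> \<sigma> i g * B = B * \<sigma> j g"
    by (rule intertwiner_component[of "irrep_copies r \<mu>" "irrep_copies r \<nu>" G \<sigma> dims M s i k t j l])
       (intro carr' M[unfolded len] comm[unfolded adapted_rep_irrep_copies]
          s(1)[unfolded len] s(2)[unfolded symmetry_types_irrep_copies]
          t(1)[unfolded len] t(2)[unfolded symmetry_types_irrep_copies] that; assumption)+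
  have "B \<noteq> 0\<^sub>m (dims i) (dims j)" using B nonzero ik jl by auto
  then have "isomorphic_reps G (dims i) (\<sigma> i) (dims j) (\<sigma> j)"
    by (intro schur_isomorphic[OF irr[OF ik(1)] irr[OF jl(1)] B(1)] comm_B)
  then have ij: "i = j" using canon ik jl by (auto simp: canonical_irreps_def)
  have "k = l" if "scalar_commutant G (dims i) (\<sigma> i)"
  proof (rule ccontr)
    assume "k \<noteq> l"
    from that B(1) comm_B obtain c where "B = c \<cdot>\<^sub>m 1\<^sub>m (dims i)"
      unfolding scalar_commutant_def ij by metis
    with \<open>k \<noteq> l\<close> ik jl ij have "B $$ (k, l) = 0" by simp
    with B nonzero show False by simp
  qed
  with ij show ?thesis by simp
qed

text \<open>
  The numbers below \<open>sum dims {..<r}\<close> are divided into consecutive ranges of lengths \<open>dims 0, dims 1, \<dots>\<close>.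
  A representation with scalar commutant uses its range fully, one number for each component; any
  other representation uses only the first number, which is available since \<open>dims i > 0\<close>.
\<close>

definition block_index ::
    "(real ^ 'd ^ 'd) set \<Rightarrow> (nat \<Rightarrow> nat) \<Rightarrow> (nat \<Rightarrow> real ^ 'd ^ 'd \<Rightarrow> real mat) \<Rightarrow> nat \<times> nat \<Rightarrow> nat" where
  "block_index G dims \<sigma> = (\<lambda>(i, k). sum dims {..<i} + (if scalar_commutant G (dims i) (\<sigma> i) then k else 0))"

lemma block_index_less:
  assumes "k < dims i"
  shows "block_index G dims \<sigma> (i, k) < sum dims {..<Suc i}"
  using assms by (simp add: block_index_def)

lemma block_index_eqD:
  assumes "block_index G dims \<sigma> (i, k) = block_index G dims \<sigma> (j, l)" "k < dims i" "l < dims j"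
  shows "i = j \<and> (scalar_commutant G (dims i) (\<sigma> i) \<longrightarrow> k = l)"
proof -
  have "block_index G dims \<sigma> (i, k) < block_index G dims \<sigma> (j, l)" if "i < j" "k < dims i" for i k j l
  proof -
    have "block_index G dims \<sigma> (i, k) < sum dims {..<Suc i}" using that by (intro block_index_less)
    also have "\<dots> \<le> sum dims {..<j}" using that by (intro sum_mono2) auto
    also have "\<dots> \<le> block_index G dims \<sigma> (j, l)" by (simp add: block_index_def)
    finally show ?thesis .
  qed
  with assms have "i = j" by (metis linorder_neqE_nat less_irrefl)
  with assms(1) show ?thesis by (auto simp: block_index_def)
qed

theorem theorem5p3:
  fixes G :: "(real ^ 'd ^ 'd) set"
    and \<Omega> :: "(real ^ 'd) set"
    and a :: "real ^ 'd \<Rightarrow> real"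
    and r m n :: nat
    and dims \<mu> \<nu> :: "nat \<Rightarrow> nat"
    and \<sigma> :: "nat \<Rightarrow> real ^ 'd ^ 'd \<Rightarrow> real mat"
    and q p :: "real ^ 'd \<Rightarrow> real vec"
  assumes "subgroup G ambient_orthogonal_group" and "finite G"
    and "canonical_irreps G r dims \<sigma>"
    and "\<forall>g\<in>G. (\<lambda>x. g *v x) ` \<Omega> = \<Omega>"
    and "\<forall>g\<in>G. \<forall>x\<in>\<Omega>. a (g *v x) = a x"
    and "symmetry_adapted_basis G \<Omega> r \<sigma> \<mu> m q"
    and "symmetry_adapted_basis G \<Omega> r \<sigma> \<nu> n p"
    and "mass_entries_well_defined \<Omega> a m n q p"
    and "stiffness_entries_well_defined \<Omega> m n q p"
  shows "\<exists>\<pi> \<tau> rs cs.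
    \<pi> permutes {..<m} \<and> \<tau> permutes {..<n} \<and>
    block_diagonal rs cs (permute_mat \<pi> \<tau> (mass_matrix \<Omega> a m n q p)) \<and>
    block_diagonal rs cs (permute_mat \<pi> \<tau> (stiffness_matrix \<Omega> m n q p)) \<and>
    length rs \<le> (\<Sum>i<r. dims i) \<and>
    blocks_separate_symmetry_types G dims \<sigma>
      ({(block_of rs s, symmetry_types r dims \<mu> ! \<pi> s) | s. s < m} \<union>
       {(block_of cs t, symmetry_types r dims \<nu> ! \<tau> t) | t. t < n})"
proof -
  let ?key = "block_index G dims \<sigma>" and ?L = "\<Sum>i<r. dims i"
  let ?mass = "mass_matrix \<Omega> a m n q p" and ?stiff = "stiffness_matrix \<Omega> m n q p"
  have G: "orthogonal_matrix g" if "g \<in> G" for g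
    using assms(1) that by (auto simp: subgroup_def ambient_orthogonal_group_def)
  have one: "Finite_Cartesian_Product.mat 1 \<in> G"
    using assms(1) by (auto simp: subgroup_def ambient_orthogonal_group_def)
  have rep: "orthogonal_rep G m (adapted_rep r \<sigma> \<mu>)" "orthogonal_rep G n (adapted_rep r \<sigma> \<nu>)"
    and basis: "\<And>x. x \<in> \<Omega> \<Longrightarrow> q x \<in> carrier_vec m" "\<And>x. x \<in> \<Omega> \<Longrightarrow> p x \<in> carrier_vec n"
      "\<And>g x. g \<in> G \<Longrightarrow> x \<in> \<Omega> \<Longrightarrow> q (g *v x) = adapted_rep r \<sigma> \<mu> g *\<^sub>v q x"
      "\<And>g x. g \<in> G \<Longrightarrow> x \<in> \<Omega> \<Longrightarrow> p (g *v x) = adapted_rep r \<sigma> \<nu> g *\<^sub>v p x"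
    using assms(6,7) by (auto simp: symmetry_adapted_basis_def symmetry_respecting_basis_def)
  have len: "length (symmetry_types r dims \<mu>) = m" "length (symmetry_types r dims \<nu>) = n"
    using length_symmetry_types[OF assms(3) _ one] rep by auto
  have types: "i < r" "k < dims i"
    if "symmetry_types r dims \<kappa> ! s = (i, k)" "s < length (symmetry_types r dims \<kappa>)" for \<kappa> s i k
    using symmetry_types_bounds[of i k r dims \<kappa>] nth_mem[OF that(2)] that(1) by auto
  have bound: "?key (symmetry_types r dims \<kappa> ! s) < ?L" if "s < length (symmetry_types r dims \<kappa>)" for \<kappa> s
  proof -
    obtain i k where ik: "symmetry_types r dims \<kappa> ! s = (i, k)" by fastforce
    have "?key (i, k) < sum dims {..<Suc i}" by (rule block_index_less[of k dims i, OF types(2)[OF ik that]])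
    also have "\<dots> \<le> ?L" using types(1)[OF ik that] by (intro sum_mono2) auto
    finally show ?thesis by (simp add: ik)
  qed
  obtain \<pi> rs where \<pi>: "\<pi> permutes {..<m}" "length rs = ?L" "sum_list rs = m"
    "\<And>s. s < m \<Longrightarrow> block_of rs s = ?key (symmetry_types r dims \<mu> ! \<pi> s)"
    by (rule sort_by_key[of m "\<lambda>s. ?key (symmetry_types r dims \<mu> ! s)" ?L])
       (use bound[of _ \<mu>] len(1) in simp, rule that)
  obtain \<tau> cs where \<tau>: "\<tau> permutes {..<n}" "length cs = ?L" "sum_list cs = n"
    "\<And>t. t < n \<Longrightarrow> block_of cs t = ?key (symmetry_types r dims \<nu> ! \<tau> t)"
    by (rule sort_by_key[of n "\<lambda>t. ?key (symmetry_types r dims \<nu> ! t)" ?L])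
       (use bound[of _ \<nu>] len(2) in simp, rule that)
  have blocks: "block_diagonal rs cs (permute_mat \<pi> \<tau> M)"
    if M: "M \<in> carrier_mat m n"
      and comm: "\<And>g. g \<in> G \<Longrightarrow> adapted_rep r \<sigma> \<mu> g * M = M * adapted_rep r \<sigma> \<nu> g" for M
  proof (rule block_diagonal_permute_mat[OF \<pi>(1) \<tau>(1) _ \<pi>(3) \<tau>(3) \<pi>(4) \<tau>(4) M])
    show "length rs = length cs" using \<pi>(2) \<tau>(2) by simp
    fix s t assume st: "s < m" "t < n"
      and ne: "?key (symmetry_types r dims \<mu> ! s) \<noteq> ?key (symmetry_types r dims \<nu> ! t)"
    obtain i k j l where eq: "symmetry_types r dims \<mu> ! s = (i, k)" "symmetry_types r dims \<nu> ! t = (j, l)"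
      by fastforce
    show "M $$ (s, t) = 0"
    proof (rule ccontr)
      assume "M $$ (s, t) \<noteq> 0"
      then have "i = j \<and> (scalar_commutant G (dims i) (\<sigma> i) \<longrightarrow> k = l)"
        using intertwiner_nonzero_entry[OF assms(3) _ comm _ eq(1) _ eq(2)] M st len by simp
      with ne eq show False by (auto simp: block_index_def split: if_splits)
    qed
  qed
  have "block_diagonal rs cs (permute_mat \<pi> \<tau> ?mass)"
  proof (rule blocks)
    show "?mass \<in> carrier_mat m n" by (simp add: mass_matrix_def)
    show "adapted_rep r \<sigma> \<mu> g * ?mass = ?mass * adapted_rep r \<sigma> \<nu> g" if g: "g \<in> G" for g
      using assms(4,5) g
      by (intro mass_matrix_intertwiner[OF G[OF g] _ _ basis(1) basis(3)[OF g] basis(2) basis(4)[OF g]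
            orthogonal_repD(1)[OF rep(1) g] orthogonal_repD(1,2)[OF rep(2) g] assms(8)]) auto
  qed
  moreover have "block_diagonal rs cs (permute_mat \<pi> \<tau> ?stiff)"
  proof (rule blocks)
    show "?stiff \<in> carrier_mat m n" by (simp add: stiffness_matrix_def)
    show "adapted_rep r \<sigma> \<mu> g * ?stiff = ?stiff * adapted_rep r \<sigma> \<nu> g" if g: "g \<in> G" for g
      using assms(4) g
      by (intro stiffness_matrix_intertwiner[OF G[OF g] _ basis(1) basis(3)[OF g] basis(2) basis(4)[OF g]
            orthogonal_repD(1)[OF rep(1) g] orthogonal_repD(1,2)[OF rep(2) g] assms(9)]) auto
  qed
  moreover have "blocks_separate_symmetry_types G dims \<sigma>
      ({(block_of rs s, symmetry_types r dims \<mu> ! \<pi> s) | s. s < m} \<union>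
       {(block_of cs t, symmetry_types r dims \<nu> ! \<tau> t) | t. t < n})"
    (is "blocks_separate_symmetry_types G dims \<sigma> ?S")
  proof -
    have key: "b = ?key (i, k) \<and> k < dims i" if "(b, (i, k)) \<in> ?S" for b i k
      using that
    proof
      assume "(b, (i, k)) \<in> {(block_of rs s, symmetry_types r dims \<mu> ! \<pi> s) | s. s < m}"
      then obtain s where s: "s < m" "b = block_of rs s" "symmetry_types r dims \<mu> ! \<pi> s = (i, k)" by auto
      moreover have "\<pi> s < m" using permutes_in_image[OF \<pi>(1), of s] s(1) by simp
      ultimately show ?thesis using \<pi>(4)[OF s(1)] types(2)[OF s(3)] len by simp
    next
      assume "(b, (i, k)) \<in> {(block_of cs t, symmetry_types r dims \<nu> ! \<tau> t) | t. t < n}"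
      then obtain t where t: "t < n" "b = block_of cs t" "symmetry_types r dims \<nu> ! \<tau> t = (i, k)" by auto
      moreover have "\<tau> t < n" using permutes_in_image[OF \<tau>(1), of t] t(1) by simp
      ultimately show ?thesis using \<tau>(4)[OF t(1)] types(2)[OF t(3)] len by simp
    qed
    show ?thesis
      unfolding blocks_separate_symmetry_types_def
    proof (intro allI impI, elim conjE)
      fix b i k i' k' assume "(b, (i, k)) \<in> ?S" "(b, (i', k')) \<in> ?S"
      then have "?key (i, k) = ?key (i', k')" "k < dims i" "k' < dims i'"
        using key[of b i k] key[of b i' k'] by simp_all
      then show "i = i' \<and> (scalar_commutant G (dims i) (\<sigma> i) \<longrightarrow> k = k')"
        by (rule block_index_eqD)
    qed
  qed
  moreover have "length rs \<le> ?L" by (simp add: \<pi>(2))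
  ultimately show ?thesis
    using \<pi>(1) \<tau>(1) by (intro exI[of _ \<pi>] exI[of _ \<tau>] exI[of _ rs] exI[of _ cs] conjI)
qed

end
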